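(* Let $\nu$ be a Borel probability measure on $\mathbb{R}^d$ whose support lies in the interior of $[0,1]^d$, and assume that there are $a>0$ and $C\ge1$ with $\nu(Q)\le C2^{-ak}$ for all $Q\in\mathcal D_k$, $k\ge0$. Let $0<t<1$. (1) One has $$\mathcal L_\nu(t)=\sum_{Q\in\mathcal D,\ \nu(Q)\ge t}\nu(Q)=\sum_{Q\in S_t}\nu(Q),$$ and $\#S_t\le t^{-1}K(t)$. (2) For every $P\in\Pi$, $$\#P=1+(2^d-1)\,\#S(P),\qquad \mathcal L(P)=\sum_{Q\in S(P)}\nu(Q).$$ (3) The family $\widetilde P_\nu(t)=\{Q\in\mathcal D\setminus\mathcal D_0:\ \nu(Q)<t\le\nu(Q^-)\}$ consists of $P_\nu(t)$ and the null children (children of $\nu$-measure zero) of cubes in $S_t$; it belongs to $\Pi$ and satisfies $S(\widetilde P_\nu(t))=S_t$, $\#\widetilde P_\nu(t)=N_t\ge M_\nu(t)$ and $\mathcal L(\widetilde P_\nu(t))=\mathcal L_\nu(t)$. Every $P\in\Pi$ with $\#P\le N_t$ satisfies $\mathcal L(P)\le\mathcal L_\nu(t)$. Consequently $\Gamma_\nu(N_t)=\mathcal L_\nu(t)$. (4) There is a constant $C_3$ depending only on $a,C,d$ such that for all $N\ge1$ and $0<t<1$, $$\Gamma_\nu(N)\le B_\nu(N)\le\Gamma_\nu(N_t)+C_3Nt\bigl(1+\log(1/t)\bigr),$$ and $$\underline D_0(\nu)=\liminf_{N\to\infty}\frac{\log N}{\Gamma_\nu(N)},\qquad \overline D_0(\nu)=\limsup_{N\to\infty}\frac{\log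 N}{\Gamma_\nu(N)}.$$
   Context: $\log$ is the logarithm to base 2, $\ln$ the natural logarithm; $\mathbb{R}^d$ carries the maximum norm. $\mathcal D_k$ is the partition of the root cube $[0,1]^d$ into $2^{dk}$ dyadic cubes of side length $2^{-k}$ (half-open cubes, with the outer boundary faces of $[0,1]^d$ assigned to the adjacent end cubes, so that the partitions are disjoint and nested, $\mathcal D_0=\{[0,1]^d\}$); $\mathcal D=\bigcup_{k\ge0}\mathcal D_k$. For $Q\in\mathcal D_k$ put $k(Q)=k$ (its generation), $\ell(Q)=2^{-k}$, and let $Q^-\in\mathcal D_{k-1}$ be the immediate dyadic parent ($k\ge1$). Stopping partition: $P_\nu(t)=\{Q\in\mathcal D\setminus\mathcal D_0:0<\nu(Q)<t\le\nu(Q^-)\}$, $M_\nu(t)=\#P_\nu(t)$, $\mathcal L_\nu(t)=-\sum_{Q\in P_\nu(t)}\nu(Q)\log\ell(Q)$, and $K(t)=1+\frac{\log(1/t)+\log C}{a}$. $S_t=\{Q\in\mathcal D:\nu(Q)\ge t\}$ and $N_t=1+(2^d-1)\#S_t$. $\Pi$ is the set of finite partitions of the root cube into cubes from $\mathcal D$ (null cubes are retained here). For $P\in\Pi$, $S(P)\subset\mathcal D$ is the set of cubes strictly containing a member of $P$, $\mathcal L(P)=\sum_{Q\in P}\nu(Q)k(Q)$, and $\Gamma_\nu(N)=\sup\{\mathcal L(P):P\in\Pi,\ \#P\le N\}$. Quantization: for $N\ge1$, $\mathfrak e_{N,0}(\nu)=\inf_{1\le\#A\le N}\exp\bigl(\int\ln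 d(x,A)\,d\nu(x)\bigr)$, infimum over non-empty finite $A\subset\mathbb{R}^d$, $d(x,A)=\inf_{y\in A}\|x-y\|_\infty$; $B_\nu(N)=-\log\mathfrak e_{N,0}(\nu)$; $\underline D_0(\nu)=\liminf_{N\to\infty}\frac{\log N}{B_\nu(N)}$ and $\overline D_0(\nu)=\limsup_{N\to\infty}\frac{\log N}{B_\nu(N)}$. *)

theory Defs
  imports "HOL-Analysis.Analysis" "HOL-Probability.Probability_Measure"
begin

section \<open>Dyadic cubes\<close>

text \<open>Half-open intervals of length $2^{-k}$; the last one in each generation also receives
  the endpoint 1.\<close>
definition dyadic_ivl :: "nat \<Rightarrow> nat \<Rightarrow> real set" where
  "dyadic_ivl k m =
     (if Suc m = 2 ^ k then {real m / 2 ^ k .. 1} else {real m / 2 ^ k ..< real (Suc m) / 2 ^ k})"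

definition root_cube :: "(real ^ 'n) set" where
  "root_cube = {x. \<forall>i. x $ i \<in> {0..1}}"

definition dyadic_gen :: "nat \<Rightarrow> (real ^ 'n) set set" where
  "dyadic_gen k = {{x. \<forall>i. x $ i \<in> dyadic_ivl k (m i)} | m :: 'n \<Rightarrow> nat. \<forall>i. m i < 2 ^ k}"

definition dyadic :: "(real ^ 'n) set set" where
  "dyadic = (\<Union>k. dyadic_gen k)"

definition gen :: "(real ^ 'n) set \<Rightarrow> nat" where
  "gen Q = (THE k. Q \<in> dyadic_gen k)"

definition side :: "(real ^ 'n) set \<Rightarrow> real" where
  "side Q = 2 powr (- real (gen Q))"

text \<open>Only meaningful for \<open>Q \<in> dyadic - dyadic_gen 0\<close>.\<close>
definition parent :: "(real ^ 'n) set \<Rightarrow> (real ^ 'n) set" where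
  "parent Q = (THE R. R \<in> dyadic_gen (gen Q - 1) \<and> Q \<subseteq> R)"


section \<open>The standing assumption on the measure\<close>

definition msupport :: "'a::topological_space measure \<Rightarrow> 'a set" where
  "msupport \<nu> = {x. \<forall>U. open U \<and> x \<in> U \<longrightarrow> emeasure \<nu> U > 0}"

definition dyadic_regular :: "real \<Rightarrow> real \<Rightarrow> (real ^ 'n) measure \<Rightarrow> bool" where
  "dyadic_regular a C \<nu> \<longleftrightarrow>
     prob_space \<nu> \<and> sets \<nu> = sets borel \<and>
     msupport \<nu> \<subseteq> interior root_cube \<and>
     (\<forall>k. \<forall>Q \<in> dyadic_gen k. measure \<nu> Q \<le> C * 2 powr (- a * real k))"


section \<open>Stopping partitions\<close>

definition stop_part :: "(real ^ 'n) measure \<Rightarrow> real \<Rightarrow> (real ^ 'n) set set" where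
  "stop_part \<nu> t = {Q \<in> dyadic - dyadic_gen 0.
     0 < measure \<nu> Q \<and> measure \<nu> Q < t \<and> t \<le> measure \<nu> (parent Q)}"

definition stop_part_full :: "(real ^ 'n) measure \<Rightarrow> real \<Rightarrow> (real ^ 'n) set set" where
  "stop_part_full \<nu> t = {Q \<in> dyadic - dyadic_gen 0. measure \<nu> Q < t \<and> t \<le> measure \<nu> (parent Q)}"

definition stop_card :: "(real ^ 'n) measure \<Rightarrow> real \<Rightarrow> nat" where
  "stop_card \<nu> t = card (stop_part \<nu> t)"

definition stop_cost :: "(real ^ 'n) measure \<Rightarrow> real \<Rightarrow> real" where
  "stop_cost \<nu> t = - (\<Sum>Q \<in> stop_part \<nu> t. measure \<nu> Q * log 2 (side Q))"

definition Kbound :: "real \<Rightarrow> real \<Rightarrow> real \<Rightarrow> real" where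
  "Kbound a C t = 1 + (log 2 (1 / t) + log 2 C) / a"

definition big_cubes :: "(real ^ 'n) measure \<Rightarrow> real \<Rightarrow> (real ^ 'n) set set" where
  "big_cubes \<nu> t = {Q \<in> dyadic. measure \<nu> Q \<ge> t}"

definition null_children :: "(real ^ 'n) measure \<Rightarrow> (real ^ 'n) set set \<Rightarrow> (real ^ 'n) set set" where
  "null_children \<nu> S = {Q \<in> dyadic - dyadic_gen 0. parent Q \<in> S \<and> measure \<nu> Q = 0}"

definition Nt :: "(real ^ 'n) measure \<Rightarrow> real \<Rightarrow> nat" where
  "Nt \<nu> t = 1 + (2 ^ CARD('n) - 1) * card (big_cubes \<nu> t)"


section \<open>Dyadic partitions\<close>

definition dyadic_partitions :: "(real ^ 'n) set set set" where
  "dyadic_partitions = {P. finite P \<and> P \<subseteq> dyadic \<and> partition_on root_cube P}"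

definition split_cubes :: "(real ^ 'n) set set \<Rightarrow> (real ^ 'n) set set" where
  "split_cubes P = {Q \<in> dyadic. \<exists>R \<in> P. R \<subset> Q}"

definition part_cost :: "(real ^ 'n) measure \<Rightarrow> (real ^ 'n) set set \<Rightarrow> real" where
  "part_cost \<nu> P = (\<Sum>Q \<in> P. measure \<nu> Q * real (gen Q))"

text \<open>For a finite measure and \<open>N \<ge> 1\<close> this is the supremum of a non-empty bounded set: there are
  only finitely many dyadic partitions with at most \<open>N\<close> members.\<close>
definition Gam :: "(real ^ 'n) measure \<Rightarrow> nat \<Rightarrow> real" where
  "Gam \<nu> N = (SUP P \<in> {P \<in> dyadic_partitions. card P \<le> N}. part_cost \<nu> P)"


section \<open>Geometric mean quantization error\<close>

text \<open>Extended logarithm, exponential and integral, so that \<open>ln 0 = -\<infinity>\<close>, \<open>exp (-\<infinity>) = 0\<close> and a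
  divergent integral keep their usual meaning.\<close>

definition eln :: "ereal \<Rightarrow> ereal" where
  "eln x = (if x \<le> 0 then - \<infinity> else if x = \<infinity> then \<infinity> else ereal (ln (real_of_ereal x)))"

definition eexp :: "ereal \<Rightarrow> ereal" where
  "eexp x = (if x = - \<infinity> then 0 else if x = \<infinity> then \<infinity> else ereal (exp (real_of_ereal x)))"

definition elog2 :: "ereal \<Rightarrow> ereal" where
  "elog2 x = eln x / ereal (ln 2)"

text \<open>Positive minus negative part; \<open>e2ennreal\<close> sends negative numbers to 0.\<close>
definition eintegral :: "'a measure \<Rightarrow> ('a \<Rightarrow> ereal) \<Rightarrow> ereal" where
  "eintegral M f = enn2ereal (\<integral>\<^sup>+ x. e2ennreal (f x) \<partial>M) - enn2ereal (\<integral>\<^sup>+ x. e2ennreal (- f x) \<partial>M)"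

definition max_dist :: "real ^ 'n \<Rightarrow> (real ^ 'n) set \<Rightarrow> real" where
  "max_dist x A = (INF y \<in> A. infnorm (x - y))"

definition quant_err0 :: "(real ^ 'n) measure \<Rightarrow> nat \<Rightarrow> ereal" where
  "quant_err0 \<nu> N = (INF A \<in> {A. finite A \<and> 1 \<le> card A \<and> card A \<le> N}.
     eexp (eintegral \<nu> (\<lambda>x. eln (ereal (max_dist x A)))))"

definition Bq :: "(real ^ 'n) measure \<Rightarrow> nat \<Rightarrow> ereal" where
  "Bq \<nu> N = - elog2 (quant_err0 \<nu> N)"

definition lower_D0 :: "(real ^ 'n) measure \<Rightarrow> ereal" where
  "lower_D0 \<nu> = liminf (\<lambda>N. ereal (log 2 (real N)) / Bq \<nu> N)"

definition upper_D0 :: "(real ^ 'n) measure \<Rightarrow> ereal" where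
  "upper_D0 \<nu> = limsup (\<lambda>N. ereal (log 2 (real N)) / Bq \<nu> N)"

end

theory Submission
  imports Defs "HOL-Real_Asymp.Real_Asymp"
begin

text \<open>A dyadic partition \<open>P\<close> is the set of leaves of a full \<open>2 ^ CARD('n)\<close>-ary tree with inner nodes
  \<open>split_cubes P\<close>. Since a cube of generation \<open>k\<close> has \<open>k\<close> strict dyadic ancestors, exchanging two
  sums writes the cost of \<open>P\<close> as the total mass of the inner nodes, so for a given number of leaves
  it is largest when the inner nodes are the heaviest cubes, that is, for a stopping partition.

  A point chosen in every member of \<open>P\<close> shows \<open>Gam \<le> Bq\<close>. Conversely \<open>- log 2 d(x,A)\<close> is at most
  the number of \<open>k\<close> with \<open>d(x,A) < 1 / 2 ^ k\<close>, and the points satisfying this inequality lie in at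
  most \<open>3 ^ CARD('n) * card A\<close> cubes of generation \<open>k\<close>. Summed over \<open>k\<close>, those of mass at least
  \<open>t\<close> contribute at most \<open>stop_cost \<nu> t\<close>, and each of the others at most the minimum of
  \<open>t\<close> and \<open>C * 2 powr (- a * k)\<close>.\<close>

section \<open>Geometry of dyadic cubes\<close>

text \<open>The obstacle in the limits is that the error \<open>N * t * (1 + log 2 (1 / t))\<close>
  must stay bounded, whereas a small \<open>t\<close> makes \<open>Nt \<nu> t\<close> large. With L
  = 1 + log N, the choice t = 1 / (N * L) keeps the error bounded. In one generation at most 1 / t
  cubes have mass at least \<open>t\<close>, and only about log (1 / t) generations contain any, so
  \<open>Nt \<nu> t\<close> is at most a constant times N * L^2. Hence \<open>Bq\<close> at N is
  compared with \<open>Gam\<close> at an index that exceeds N only by a power of log N, and the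
  logarithm of the index is asymptotically unchanged. The error itself comes from the light cubes.
  Up to a generation that is linear in log (1 / t) the bound \<open>t\<close> is used, and after it
  a geometric tail with ratio \<open>2 powr (- a)\<close>; together they give t * (1 + log (1 / t))
  up to a factor depending on \<open>a\<close> and \<open>C\<close>. The factor
  \<open>3 ^ CARD('n)\<close> is a bound for the number of cubes of side 1 / 2^k that come closer
  than 1 / 2^k to a given point.\<close>

lemma mem_dyadic_ivl:
  assumes "m < 2 ^ k"
  shows "r \<in> dyadic_ivl k m \<longleftrightarrow>
    real m \<le> r * 2 ^ k \<and> (r * 2 ^ k < real m + 1 \<or> r = 1 \<and> Suc m = 2 ^ k)"
proof (cases "Suc m = 2 ^ k")
  case True
  then have "real m + 1 = 2 ^ k"
    by (metis of_nat_Suc of_nat_numeral of_nat_power add.commute)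
  \<comment> \<open>In the last interval the closed bound is r * 2^k <= m + 1, with equality exactly
    at r = 1. Splitting it off lets both kinds of interval share one description.\<close>
  then have "r \<le> 1 \<longleftrightarrow> r * 2 ^ k < real m + 1 \<or> r = 1"
    by auto
  with True show ?thesis
    by (auto simp: dyadic_ivl_def field_simps)
next
  case False
  then show ?thesis
    by (auto simp: dyadic_ivl_def field_simps)
qed

lemma dyadic_ivl_subset:
  assumes "m < 2 ^ k"
  shows "dyadic_ivl k m \<subseteq> {0..1}"
proof
  fix r assume "r \<in> dyadic_ivl k m"
  then have *: "real m \<le> r * 2 ^ k" "r * 2 ^ k < real m + 1 \<or> r = 1 \<and> Suc m = 2 ^ k"
    using mem_dyadic_ivl[OF assms] by auto
  have "real m + 1 \<le> 2 ^ k"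
    using assms by (metis Suc_eq_plus1 Suc_leI of_nat_1 of_nat_add of_nat_le_iff of_nat_numeral of_nat_power)
  then have "r * 2 ^ k \<le> 2 ^ k" using *(2) by (elim disjE) (linarith, simp)
  moreover have "0 \<le> r * 2 ^ k" using *(1) by linarith
  moreover have "r \<le> 1"
  proof (rule ccontr)
    assume "\<not> r \<le> 1"
    then have "1 * 2 ^ k < r * 2 ^ k" by (intro mult_strict_right_mono) auto
    with calculation(1) show False by simp
  qed
  ultimately show "r \<in> {0..1}"
    using mult_right_le_imp_le[of 0 "2 ^ k" r] by simp
qed

lemma dyadic_ivl_disjoint:
  assumes "m < 2 ^ k" "n < 2 ^ k" "r \<in> dyadic_ivl k m" "r \<in> dyadic_ivl k n"
  shows "m = n"
proof -
  have "real m + 1 \<le> 2 ^ k" "real n + 1 \<le> 2 ^ k"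
    using assms(1,2) by (metis Suc_eq_plus1 Suc_leI of_nat_1 of_nat_add of_nat_le_iff of_nat_numeral of_nat_power)+
  with assms(3,4) have "real m < real n + 1 \<and> real n < real m + 1 \<or> Suc m = Suc n"
    unfolding mem_dyadic_ivl[OF assms(1)] mem_dyadic_ivl[OF assms(2)] by auto
  then show ?thesis by linarith
qed

lemma dyadic_ivl_cover:
  assumes "0 \<le> r" "r \<le> 1"
  obtains m where "m < 2 ^ k" "r \<in> dyadic_ivl k m"
proof (cases "r = 1")
  case True
  have "2 ^ k - 1 < (2::nat) ^ k" by simp
  moreover have "r \<in> dyadic_ivl k (2 ^ k - 1)"
    using True mem_dyadic_ivl[OF calculation] by (simp add: of_nat_diff)
  ultimately show ?thesis using that by blast
next
  case False
  define m where "m = nat \<lfloor>r * 2 ^ k\<rfloor>"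
  have m: "real m \<le> r * 2 ^ k" "r * 2 ^ k < real m + 1"
    using assms unfolding m_def by (auto intro: of_nat_floor)
  have "r * 2 ^ k < 1 * 2 ^ k"
    using assms False by (intro mult_strict_right_mono) auto
  with m(1) have "real m < 2 ^ k" by linarith
  then have "m < 2 ^ k" by (metis of_nat_less_iff of_nat_numeral of_nat_power)
  with m that mem_dyadic_ivl show ?thesis by blast
qed

lemma dyadic_ivl_parent:
  assumes "m < 2 ^ Suc k"
  shows "dyadic_ivl (Suc k) m \<subseteq> dyadic_ivl k (m div 2)"
proof
  fix r assume r: "r \<in> dyadic_ivl (Suc k) m"
  have m2: "m div 2 < 2 ^ k" using assms by auto
  have "2 * (m div 2) \<le> m" "m + 1 \<le> 2 * (m div 2 + 1)" by presburger+
  then have "real (2 * (m div 2)) \<le> real m" "real (m + 1) \<le> real (2 * (m div 2 + 1))"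
    by (auto simp only: of_nat_le_iff)
  then have "2 * real (m div 2) \<le> real m" "real m + 1 \<le> 2 * (real (m div 2) + 1)"
    by simp_all
  moreover have "Suc (m div 2) = 2 ^ k" if "Suc m = 2 ^ Suc k"
    using that by auto
  ultimately show "r \<in> dyadic_ivl k (m div 2)"
    using r unfolding mem_dyadic_ivl[OF assms] mem_dyadic_ivl[OF m2] by auto
qed

lemma dyadic_ivl_diam:
  assumes "m < 2 ^ k" "r \<in> dyadic_ivl k m" "s \<in> dyadic_ivl k m"
  shows "\<bar>r - s\<bar> \<le> 1 / 2 ^ k"
proof -
  have *: "real m \<le> u * 2 ^ k \<and> u * 2 ^ k \<le> real m + 1" if "u \<in> dyadic_ivl k m" for u
    using that unfolding mem_dyadic_ivl[OF assms(1)]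
    by (metis add.commute less_imp_le mult_1 of_nat_Suc of_nat_numeral of_nat_power order_refl)
  have "\<bar>r - s\<bar> * 2 ^ k = \<bar>r * 2 ^ k - s * 2 ^ k\<bar>"
    by (simp add: abs_mult left_diff_distrib[symmetric])
  also have "\<dots> \<le> 1"
    using *[OF assms(2)] *[OF assms(3)] by linarith
  finally show ?thesis by (simp add: field_simps)
qed

lemma dyadic_ivl_mem:
  assumes "m < 2 ^ k" "0 \<le> s" "s < 1"
  shows "(real m + s) / 2 ^ k \<in> dyadic_ivl k m"
  using assms mem_dyadic_ivl[OF assms(1)] by simp

text \<open>The cubes of a generation become the image of an explicit index set under an injective
  map, so that they can be counted.\<close>

definition dyadic_cell :: "nat \<Rightarrow> ('n \<Rightarrow> nat) \<Rightarrow> (real ^ 'n) set" where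
  "dyadic_cell k m = {x. \<forall>i. x $ i \<in> dyadic_ivl k (m i)}"

lemma dyadic_gen_eq: "dyadic_gen k = dyadic_cell k ` {m. \<forall>i. m i < 2 ^ k}"
  unfolding dyadic_gen_def dyadic_cell_def by auto

lemma mem_dyadic_cell: "x \<in> dyadic_cell k m \<longleftrightarrow> (\<forall>i. x $ i \<in> dyadic_ivl k (m i))"
  unfolding dyadic_cell_def by simp

text \<open>The offset s = 0 gives the lower corner and hence non-emptiness; s = 3/4 gives a second
  point, from which the size of the cube can be read off.\<close>

lemma dyadic_cell_point:
  assumes "\<forall>i. m i < 2 ^ k" "0 \<le> s" "s < 1"
  shows "(\<chi> i. (real (m i) + s) / 2 ^ k) \<in> dyadic_cell k m"
  using assms dyadic_ivl_mem by (auto simp: mem_dyadic_cell)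

lemma dyadic_cell_inject:
  assumes "\<forall>i. m i < 2 ^ k" "\<forall>i. n i < 2 ^ k" "x \<in> dyadic_cell k m" "x \<in> dyadic_cell k n"
  shows "m = n"
proof
  fix i show "m i = n i"
    using assms dyadic_ivl_disjoint[of "m i" k "n i" "x $ i"] by (simp add: mem_dyadic_cell)
qed

lemma inj_on_dyadic_cell: "inj_on (dyadic_cell k) {m :: 'n::finite \<Rightarrow> nat. \<forall>i. m i < 2 ^ k}"
proof (rule inj_onI)
  fix m n :: "'n \<Rightarrow> nat"
  assume "m \<in> {m. \<forall>i. m i < 2 ^ k}" "n \<in> {m. \<forall>i. m i < 2 ^ k}" "dyadic_cell k m = dyadic_cell k n"
  then show "m = n"
    using dyadic_cell_point[of m k 0] dyadic_cell_inject[of m k n] by simp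
qed

lemma dyadic_gen_nonempty: "Q \<in> dyadic_gen k \<Longrightarrow> Q \<noteq> {}"
proof -
  assume "Q \<in> dyadic_gen k"
  then obtain m where "\<forall>i. m i < 2 ^ k" "Q = dyadic_cell k m"
    unfolding dyadic_gen_eq by auto
  then show ?thesis using dyadic_cell_point[of m k 0] by auto
qed

lemma dyadic_gen_eqI:
  assumes "Q \<in> dyadic_gen k" "R \<in> dyadic_gen k" "x \<in> Q" "x \<in> R"
  shows "Q = R"
proof -
  obtain m n where "\<forall>i. m i < 2 ^ k" "Q = dyadic_cell k m" "\<forall>i. n i < 2 ^ k" "R = dyadic_cell k n"
    using assms unfolding dyadic_gen_eq by auto
  then show ?thesis using dyadic_cell_inject[of m k n x] assms by simp
qed

lemma finite_dyadic_gen: "finite (dyadic_gen k :: (real ^ 'n) set set)"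
proof -
  have "{m :: 'n \<Rightarrow> nat. \<forall>i. m i < 2 ^ k} = (\<Pi>\<^sub>E i\<in>UNIV. {..<2 ^ k})"
    by (auto simp: PiE_def Pi_def)
  then have "finite {m :: 'n::finite \<Rightarrow> nat. \<forall>i. m i < 2 ^ k}"
    by (simp add: finite_PiE)
  then show ?thesis
    unfolding dyadic_gen_eq by (rule finite_imageI)
qed

lemma dyadic_gen_subset_root: "Q \<in> dyadic_gen k \<Longrightarrow> Q \<subseteq> root_cube"
proof
  fix x assume "Q \<in> dyadic_gen k" "x \<in> Q"
  then obtain m where m: "\<forall>i. m i < 2 ^ k" "x \<in> dyadic_cell k m"
    unfolding dyadic_gen_eq by auto
  have "x $ i \<in> {0..1}" for i
    using m dyadic_ivl_subset[OF m(1)[rule_format, of i]] by (auto simp: mem_dyadic_cell)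
  then show "x \<in> root_cube" by (simp add: root_cube_def)
qed

lemma dyadic_gen_cover:
  assumes "x \<in> root_cube"
  obtains Q where "Q \<in> dyadic_gen k" "x \<in> Q"
proof -
  have "\<exists>m. m < 2 ^ k \<and> x $ i \<in> dyadic_ivl k m" for i
  proof -
    have "0 \<le> x $ i" "x $ i \<le> 1" using assms by (auto simp: root_cube_def)
    then show ?thesis by (meson dyadic_ivl_cover)
  qed
  then obtain m where "\<forall>i. m i < 2 ^ k \<and> x $ i \<in> dyadic_ivl k (m i)" by metis
  then show ?thesis
    using that[of "dyadic_cell k m"] unfolding dyadic_gen_eq mem_dyadic_cell by blast
qed

lemma dyadic_gen_0: "dyadic_gen 0 = {root_cube :: (real ^ 'n) set}"
proof -
  have "{m :: 'n \<Rightarrow> nat. \<forall>i. m i < 2 ^ 0} = {\<lambda>_. 0}" by auto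
  then show ?thesis
    unfolding dyadic_gen_eq by (simp add: dyadic_cell_def root_cube_def dyadic_ivl_def)
qed

lemma dyadic_gen_Suc_subset:
  assumes "Q \<in> dyadic_gen (Suc k)"
  obtains R where "R \<in> dyadic_gen k" "Q \<subseteq> R"
proof -
  obtain m where m: "\<forall>i. m i < 2 ^ Suc k" "Q = dyadic_cell (Suc k) m"
    using assms unfolding dyadic_gen_eq by auto
  have "m i div 2 < 2 ^ k" for i using m(1)[rule_format, of i] by auto
  then have "dyadic_cell k (\<lambda>i. m i div 2) \<in> dyadic_gen k"
    unfolding dyadic_gen_eq by auto
  moreover have "Q \<subseteq> dyadic_cell k (\<lambda>i. m i div 2)"
    using dyadic_ivl_parent[OF m(1)[rule_format]] unfolding m(2) subset_iff mem_dyadic_cell by simp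
  ultimately show ?thesis using that by blast
qed

lemma dyadic_gen_subset_ancestor:
  assumes "Q \<in> dyadic_gen k" "j \<le> k"
  shows "\<exists>R\<in>dyadic_gen j. Q \<subseteq> R"
  using assms(2,1)
proof (induction k arbitrary: Q rule: dec_induct)
  case (step n)
  obtain R where R: "R \<in> dyadic_gen n" "Q \<subseteq> R" using dyadic_gen_Suc_subset[OF step.prems] .
  then show ?case using step.IH[OF R(1)] by blast
qed auto

lemma dyadic_gen_nested:
  assumes "Q \<in> dyadic_gen k" "R \<in> dyadic_gen j" "j \<le> k" "x \<in> Q" "x \<in> R"
  shows "Q \<subseteq> R"
  using dyadic_gen_subset_ancestor[OF assms(1,3)] dyadic_gen_eqI[OF assms(2)] assms(4,5) by blast

text \<open>A cube of generation j has two points at distance 3/4 / 2^j, and this exceeds 1 /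
  2^(j+1), which bounds the diameter of every cube of a later generation. The fraction 3/4 lies
  strictly between 1/2 and the value 1 that a half-open interval does not reach. The lemma makes the
  description in \<open>gen\<close> well-defined.\<close>

lemma dyadic_gen_unique:
  fixes Q :: "(real ^ 'n) set"
  assumes "Q \<in> dyadic_gen j" "Q \<in> dyadic_gen k"
  shows "j = k"
proof -
  have *: False if h: "Q \<in> dyadic_gen j" "Q \<in> dyadic_gen k" "j < k" for j k
  proof -
    obtain m where m: "\<forall>i. m i < 2 ^ j" "Q = dyadic_cell j m"
      using h unfolding dyadic_gen_eq by auto
    obtain n where n: "\<forall>i. n i < 2 ^ k" "Q = dyadic_cell k n"
      using h unfolding dyadic_gen_eq by auto
    \<comment> \<open>One coordinate suffices for the comparison of lengths, and
      \<open>undefined\<close> names one.\<close>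
    define i :: 'n where "i = undefined"
    have "(real (m i) + s) / 2 ^ j \<in> dyadic_ivl k (n i)" if "0 \<le> s" "s < 1" for s
    proof -
      have "(\<chi> i. (real (m i) + s) / 2 ^ j) \<in> dyadic_cell k n"
        using dyadic_cell_point[OF m(1) that] m(2) n(2) by simp
      then show ?thesis unfolding mem_dyadic_cell by simp
    qed
    from this[of 0] this[of "3/4"] have "3/4 / 2 ^ j \<le> (1::real) / 2 ^ k"
      using dyadic_ivl_diam[of "n i" k "(real (m i) + 3/4) / 2 ^ j" "real (m i) / 2 ^ j"] n
      by (simp add: diff_divide_distrib[symmetric])
    also have "\<dots> \<le> 1 / 2 ^ Suc j"
      using h(3) by (intro divide_left_mono power_increasing) auto
    finally show False by (simp add: field_simps)
  qed
  show ?thesis using *[OF assms] *[OF assms(2,1)] by (meson linorder_neqE_nat)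
qed

section \<open>Generations and nesting of cubes\<close>

lemma gen_eq: "Q \<in> dyadic_gen k \<Longrightarrow> gen Q = k"
  unfolding gen_def by (rule the_equality) (auto intro: dyadic_gen_unique)

lemma dyadic_iff: "Q \<in> dyadic \<longleftrightarrow> Q \<in> dyadic_gen (gen Q)"
proof
  assume "Q \<in> dyadic"
  then obtain k where "Q \<in> dyadic_gen k" unfolding dyadic_def by auto
  then show "Q \<in> dyadic_gen (gen Q)" by (simp add: gen_eq)
qed (auto simp: dyadic_def)

lemma dyadic_genD: "Q \<in> dyadic_gen k \<Longrightarrow> Q \<in> dyadic \<and> gen Q = k"
  by (auto simp: dyadic_def gen_eq)

lemma root_cube_dyadic:
  "(root_cube :: (real ^ 'n) set) \<in> dyadic" "gen (root_cube :: (real ^ 'n) set) = 0"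
  using dyadic_genD[of "root_cube :: (real ^ 'n) set" 0] by (simp_all add: dyadic_gen_0)

lemma dyadic_nonempty: "Q \<in> dyadic \<Longrightarrow> Q \<noteq> {}"
  unfolding dyadic_iff by (rule dyadic_gen_nonempty)

lemma dyadic_subset_root: "Q \<in> dyadic \<Longrightarrow> Q \<subseteq> root_cube"
  unfolding dyadic_iff by (rule dyadic_gen_subset_root)

lemma dyadic_nested:
  "Q \<in> dyadic \<Longrightarrow> R \<in> dyadic \<Longrightarrow> gen R \<le> gen Q \<Longrightarrow> x \<in> Q \<Longrightarrow> x \<in> R \<Longrightarrow> Q \<subseteq> R"
  unfolding dyadic_iff by (rule dyadic_gen_nested)

lemma dyadic_psubset_iff:
  assumes "Q \<in> dyadic" "R \<in> dyadic" "x \<in> Q" "x \<in> R"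
  shows "Q \<subset> R \<longleftrightarrow> gen R < gen Q"
proof
  assume "Q \<subset> R"
  then show "gen R < gen Q" using dyadic_nested[of R Q x] assms by (metis leI psubsetE)
next
  assume "gen R < gen Q"
  then show "Q \<subset> R" using dyadic_nested[of Q R x] assms by auto
qed

section \<open>Parents and children\<close>

lemma parent_unique:
  assumes "Q \<in> dyadic_gen (Suc k)" "R \<in> dyadic_gen k" "Q \<subseteq> R"
  shows "parent Q = R"
proof -
  obtain x where x: "x \<in> Q" using dyadic_gen_nonempty[OF assms(1)] by auto
  have "(THE S. S \<in> dyadic_gen k \<and> Q \<subseteq> S) = R"
  proof (rule the_equality)
    show "S = R" if "S \<in> dyadic_gen k \<and> Q \<subseteq> S" for S
      using dyadic_gen_eqI[of S k R x] that assms(2,3) x by blast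
  qed (use assms in blast)
  then show ?thesis by (simp add: parent_def gen_eq[OF assms(1)])
qed

lemma dyadic_Suc_cases:
  assumes "Q \<in> dyadic - dyadic_gen 0"
  obtains k where "Q \<in> dyadic_gen (Suc k)" "parent Q \<in> dyadic_gen k" "Q \<subset> parent Q"
proof -
  obtain k where k: "Q \<in> dyadic_gen (Suc k)"
    using assms unfolding dyadic_def by (metis DiffE UN_E not0_implies_Suc)
  obtain R where R: "R \<in> dyadic_gen k" "Q \<subseteq> R" using dyadic_gen_Suc_subset[OF k] .
  have "Q \<noteq> R" using k R(1) dyadic_gen_unique by fastforce
  then show ?thesis using that[OF k] parent_unique[OF k R] R by auto
qed

text \<open>Children are fibres of the map \<open>parent\<close>, so the families of different cubes
  are disjoint at once.\<close>

definition children :: "(real ^ 'n) set \<Rightarrow> (real ^ 'n) set set" where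
  "children R = {Q \<in> dyadic - dyadic_gen 0. parent Q = R}"

lemma children_eq:
  assumes "R \<in> dyadic_gen k"
  shows "children R = {Q \<in> dyadic_gen (Suc k). Q \<subseteq> R}"
proof -
  have "Q \<in> dyadic_gen (Suc k) \<and> Q \<subseteq> R" if "Q \<in> children R" for Q
    using that assms unfolding children_def
    by (metis (mono_tags, lifting) dyadic_Suc_cases dyadic_gen_unique mem_Collect_eq psubset_imp_subset)
  moreover have "Q \<in> children R" if "Q \<in> dyadic_gen (Suc k)" "Q \<subseteq> R" for Q
    using parent_unique[OF that(1) assms that(2)] dyadic_genD[OF that(1)] dyadic_genD[of Q 0]
    unfolding children_def by auto
  ultimately show ?thesis by blast
qed

text \<open>A cell with index m lies in the cell with index n of the previous generation exactly if
  m i div 2 = n i for all i, which leaves two values of m i in every coordinate.\<close>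

lemma card_children:
  fixes R :: "(real ^ 'n) set"
  assumes "R \<in> dyadic"
  shows "card (children R) = 2 ^ CARD('n)" "finite (children R)"
proof -
  obtain k where k: "R \<in> dyadic_gen k" using assms dyadic_iff by blast
  obtain n where n: "\<forall>i. n i < 2 ^ k" "R = dyadic_cell k n"
    using k unfolding dyadic_gen_eq by auto
  let ?M = "\<Pi>\<^sub>E i\<in>UNIV. {2 * n i, 2 * n i + 1}"
  have M: "m \<in> ?M \<longleftrightarrow> (\<forall>i. m i div 2 = n i)" for m
  proof -
    have "m i \<in> {2 * n i, 2 * n i + 1} \<longleftrightarrow> m i div 2 = n i" for i
      by (simp, linarith)
    then show ?thesis by (simp add: PiE_UNIV_domain Pi_iff)
  qed
  have M': "\<forall>i. m i < 2 ^ Suc k" if "m \<in> ?M" for m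
    using that n(1) unfolding M by (metis div_less_iff_less_mult pos2 power_Suc2)
  have "children R = dyadic_cell (Suc k) ` ?M"
  proof (intro set_eqI iffI)
    fix Q assume "Q \<in> children R"
    then obtain m where m: "\<forall>i. m i < 2 ^ Suc k" "Q = dyadic_cell (Suc k) m" "Q \<subseteq> R"
      unfolding children_eq[OF k] dyadic_gen_eq by auto
    obtain x where x: "x \<in> Q" using dyadic_cell_point[OF m(1), of 0] m(2) by auto
    have "m i div 2 = n i" for i
    proof (rule dyadic_ivl_disjoint)
      show "m i div 2 < 2 ^ k" using m(1)[rule_format, of i] by auto
      show "x $ i \<in> dyadic_ivl k (m i div 2)"
        using x m(2) dyadic_ivl_parent[OF m(1)[rule_format, of i]] by (auto simp: mem_dyadic_cell)
      show "x $ i \<in> dyadic_ivl k (n i)" using x m(3) n(2) by (auto simp: mem_dyadic_cell)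
    qed (use n in auto)
    then show "Q \<in> dyadic_cell (Suc k) ` ?M" using m(2) M by blast
  next
    fix Q assume "Q \<in> dyadic_cell (Suc k) ` ?M"
    then obtain m where m: "m \<in> ?M" "Q = dyadic_cell (Suc k) m" by blast
    have "Q \<subseteq> R"
      using dyadic_ivl_parent[OF M'[OF m(1), rule_format]] m(1)
      unfolding m(2) n(2) subset_iff mem_dyadic_cell M by simp
    then show "Q \<in> children R"
      unfolding children_eq[OF k] dyadic_gen_eq using M'[OF m(1)] m(2) by blast
  qed
  moreover have "inj_on (dyadic_cell (Suc k)) ?M"
    by (rule inj_on_subset[OF inj_on_dyadic_cell]) (use M' in auto)
  moreover have "card ?M = 2 ^ CARD('n)"
    by (simp add: card_PiE numeral_2_eq_2)
  ultimately show "card (children R) = 2 ^ CARD('n)" "finite (children R)"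
    by (simp_all add: card_image finite_PiE)
qed

lemma disjoint_children:
  "R \<noteq> R' \<Longrightarrow> children R \<inter> children R' = {}"
  unfolding children_def by auto

section \<open>Dyadic partitions\<close>

lemma dyadic_partitionsD:
  assumes "P \<in> dyadic_partitions"
  shows "finite P" "P \<subseteq> dyadic" "\<Union>P = root_cube"
    and "\<And>Q R x. Q \<in> P \<Longrightarrow> R \<in> P \<Longrightarrow> x \<in> Q \<Longrightarrow> x \<in> R \<Longrightarrow> Q = R"
proof -
  show "finite P" "P \<subseteq> dyadic" "\<Union>P = root_cube"
    using assms unfolding dyadic_partitions_def partition_on_def by auto
  fix Q R x assume "Q \<in> P" "R \<in> P" "x \<in> Q" "x \<in> R"
  moreover have "disjoint P"
    using assms unfolding dyadic_partitions_def partition_on_def by auto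
  ultimately show "Q = R" unfolding pairwise_def disjnt_def by blast
qed

text \<open>A point of \<open>R\<close> lies in some member of \<open>P\<close>, and dyadic cubes
  with a common point are comparable.\<close>

lemma dyadic_partitions_member:
  assumes "P \<in> dyadic_partitions" "R \<in> dyadic"
  obtains Q where "Q \<in> P" "Q \<subseteq> R \<or> R \<subset> Q"
proof -
  obtain x where x: "x \<in> R" using dyadic_nonempty[OF assms(2)] by auto
  then have "x \<in> \<Union>P" using dyadic_partitionsD(3)[OF assms(1)] dyadic_subset_root[OF assms(2)] by blast
  then obtain Q where Q: "Q \<in> P" "x \<in> Q" by blast
  then have "Q \<in> dyadic" using dyadic_partitionsD(2)[OF assms(1)] by blast
  then have "Q \<subseteq> R \<or> R \<subset> Q"
    using dyadic_nested[OF _ assms(2) _ Q(2) x] dyadic_psubset_iff[OF assms(2) _ x Q(2)] by (meson leI)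
  with Q(1) that show ?thesis by blast
qed

text \<open>Every generation below that of \<open>Q\<close> contains exactly one cube above
  \<open>Q\<close>, so \<open>gen\<close> maps these cubes bijectively onto the smaller
  numbers.\<close>

lemma
  assumes Q: "Q \<in> dyadic"
  shows finite_ancestors: "finite {R \<in> dyadic. Q \<subset> R}"
    and card_ancestors: "card {R \<in> dyadic. Q \<subset> R} = gen Q"
proof -
  obtain x where x: "x \<in> Q" using dyadic_nonempty[OF Q] by auto
  have "bij_betw gen {R \<in> dyadic. Q \<subset> R} {..<gen Q}"
  proof (rule bij_betw_imageI)
    show "inj_on gen {R \<in> dyadic. Q \<subset> R}"
    proof (rule inj_onI)
      fix R R' assume R: "R \<in> {R \<in> dyadic. Q \<subset> R}" "R' \<in> {R \<in> dyadic. Q \<subset> R}" "gen R = gen R'"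
      then have "x \<in> R" "x \<in> R'" using x by auto
      then show "R = R'" using dyadic_nested[of R R' x] dyadic_nested[of R' R x] R by auto
    qed
    show "gen ` {R \<in> dyadic. Q \<subset> R} = {..<gen Q}"
    proof (intro set_eqI iffI)
      fix j assume "j \<in> gen ` {R \<in> dyadic. Q \<subset> R}"
      then obtain R where R: "R \<in> dyadic" "Q \<subset> R" "j = gen R" by blast
      then have "x \<in> R" using x by auto
      then show "j \<in> {..<gen Q}" using dyadic_psubset_iff[OF Q R(1) x] R by simp
    next
      fix j assume j: "j \<in> {..<gen Q}"
      then obtain R where R: "R \<in> dyadic_gen j" "Q \<subseteq> R"
        using dyadic_gen_subset_ancestor[of Q "gen Q" j] Q[unfolded dyadic_iff] by auto
      then have "x \<in> R" using x by auto
      then have "Q \<subset> R"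
        using dyadic_psubset_iff[OF Q _ x, of R] dyadic_genD[OF R(1)] j by simp
      then show "j \<in> gen ` {R \<in> dyadic. Q \<subset> R}" using dyadic_genD[OF R(1)] by blast
    qed
  qed
  then show "finite {R \<in> dyadic. Q \<subset> R}" "card {R \<in> dyadic. Q \<subset> R} = gen Q"
    by (auto simp: bij_betw_finite dest: bij_betw_same_card)
qed

lemma finite_split_cubes:
  assumes "P \<in> dyadic_partitions"
  shows "finite (split_cubes P)"
proof -
  have "split_cubes P \<subseteq> (\<Union>Q\<in>P. {R \<in> dyadic. Q \<subset> R})"
    unfolding split_cubes_def by blast
  moreover have "finite (\<Union>Q\<in>P. {R \<in> dyadic. Q \<subset> R})"
    using dyadic_partitionsD[OF assms] finite_ancestors by blast
  ultimately show ?thesis by (rule finite_subset)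
qed

lemma split_cubes_disjoint:
  assumes "P \<in> dyadic_partitions"
  shows "P \<inter> split_cubes P = {}"
proof -
  have False if R: "R \<in> P" "Q \<in> P" "Q \<subset> R" for R Q
  proof -
    obtain x where "x \<in> Q" using R(2) dyadic_nonempty dyadic_partitionsD(2)[OF assms] by blast
    then show False using dyadic_partitionsD(4)[OF assms R(1,2)] R(3) by blast
  qed
  then show ?thesis unfolding split_cubes_def by blast
qed

lemma parent_dyadic:
  assumes "Q \<in> dyadic - dyadic_gen 0"
  shows "parent Q \<in> dyadic" "Q \<subset> parent Q"
proof -
  obtain k where "Q \<in> dyadic_gen (Suc k)" "parent Q \<in> dyadic_gen k" "Q \<subset> parent Q"
    using dyadic_Suc_cases[OF assms] .
  then show "parent Q \<in> dyadic" "Q \<subset> parent Q" using dyadic_genD by auto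
qed

text \<open>There is no room for a cube strictly between \<open>Q\<close> and its parent, since
  their generations differ by one. This passes from an arbitrary larger cube to the parent, whose
  mass the stopping rule controls.\<close>

lemma dyadic_Suc_psubset:
  assumes "Q \<in> dyadic - dyadic_gen 0" "R \<in> dyadic" "Q \<subset> R"
  shows "parent Q \<subseteq> R"
proof -
  obtain k where k: "Q \<in> dyadic_gen (Suc k)" "parent Q \<in> dyadic_gen k" "Q \<subset> parent Q"
    using dyadic_Suc_cases[OF assms(1)] .
  obtain x where x: "x \<in> Q" using dyadic_gen_nonempty[OF k(1)] by auto
  have "gen R \<le> k"
    using dyadic_psubset_iff[of Q R x] assms x dyadic_genD[OF k(1)] by auto
  then show ?thesis
    using dyadic_nested[of "parent Q" R x] dyadic_genD[OF k(2)] assms x k(3) by auto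
qed

lemma children_psubset:
  assumes "Q \<in> children R"
  shows "Q \<subset> R" "Q \<in> dyadic" "R \<in> dyadic" "Q \<notin> dyadic_gen 0" "parent Q = R"
proof -
  have Q: "Q \<in> dyadic - dyadic_gen 0" "parent Q = R" using assms by (auto simp: children_def)
  then show "Q \<in> dyadic" "Q \<notin> dyadic_gen 0" "parent Q = R" by auto
  show "Q \<subset> R" "R \<in> dyadic"
    using parent_dyadic[OF Q(1)] Q(2) by simp_all
qed

text \<open>The nodes of the tree are described in two ways: as leaves and inner nodes, and as the
  root together with the children of inner nodes. Counting both sides gives the number of
  leaves.\<close>

lemma split_cubes_tree:
  assumes P: "P \<in> dyadic_partitions"
  shows "P \<union> split_cubes P = insert root_cube (\<Union>R\<in>split_cubes P. children R)"
proof (intro set_eqI iffI)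
  fix Q assume Q: "Q \<in> P \<union> split_cubes P"
  then have Qd: "Q \<in> dyadic" using dyadic_partitionsD(2)[OF P] unfolding split_cubes_def by blast
  show "Q \<in> insert root_cube (\<Union>R\<in>split_cubes P. children R)"
  proof (cases "Q \<in> dyadic_gen 0")
    case True then show ?thesis by (simp add: dyadic_gen_0)
  next
    case False
    with Qd have k: "parent Q \<in> dyadic" "Q \<subset> parent Q"
      using parent_dyadic[of Q] by simp_all
    have "\<exists>R\<in>P. R \<subset> parent Q"
      using Q k(2) unfolding split_cubes_def by auto
    with k(1) have "parent Q \<in> split_cubes P" by (simp add: split_cubes_def)
    moreover have "Q \<in> children (parent Q)" using Qd False by (simp add: children_def)
    ultimately show ?thesis by blast
  qed
next
  fix Q assume Q: "Q \<in> insert root_cube (\<Union>R\<in>split_cubes P. children R)"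
  then have Qd: "Q \<in> dyadic" using root_cube_dyadic children_psubset by blast
  obtain Q' where Q': "Q' \<in> P" "Q' \<subseteq> Q \<or> Q \<subset> Q'" using dyadic_partitions_member[OF P Qd] .
  have Qd': "Q' \<in> dyadic" using Q'(1) dyadic_partitionsD(2)[OF P] by blast
  \<comment> \<open>If a child \<open>Q\<close> of a split cube \<open>R\<close> were strictly
    inside a member \<open>Q'\<close>, then \<open>R\<close> would lie in \<open>Q'\<close> as well.
    But \<open>R\<close> strictly contains a member, so \<open>Q'\<close> would be both a leaf and
    an inner node.\<close>
  have "\<not> Q \<subset> Q'"
  proof
    assume *: "Q \<subset> Q'"
    then have "Q \<noteq> root_cube" using dyadic_subset_root[OF Qd'] by blast
    with Q obtain R where R: "R \<in> split_cubes P" "Q \<in> children R" by blast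
    have "R \<subseteq> Q'"
      using dyadic_Suc_psubset[of Q Q'] children_psubset[OF R(2)] Qd' * by blast
    moreover obtain R' where "R' \<in> P" "R' \<subset> R" using R(1) unfolding split_cubes_def by blast
    ultimately show False
      using split_cubes_disjoint[OF P] Q'(1) Qd' unfolding split_cubes_def by blast
  qed
  with Q' have "Q' \<subseteq> Q" by blast
  then show "Q \<in> P \<union> split_cubes P"
    using Q'(1) Qd unfolding split_cubes_def by blast
qed

text \<open>With s inner nodes there are card P + s nodes in all, and also 1 + 2^d * s, because each
  node except the root is a child of exactly one inner node.\<close>

lemma card_dyadic_partition:
  fixes P :: "(real ^ 'n) set set"
  assumes P: "P \<in> dyadic_partitions"
  shows "card P = 1 + (2 ^ CARD('n) - 1) * card (split_cubes P)"
proof -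
  let ?S = "split_cubes P"
  have S: "finite ?S" "finite P" "?S \<subseteq> dyadic"
    using finite_split_cubes[OF P] dyadic_partitionsD(1)[OF P] by (auto simp: split_cubes_def)
  have "card P + card ?S = card (P \<union> ?S)"
    using S split_cubes_disjoint[OF P] by (simp add: card_Un_disjoint)
  also have "\<dots> = Suc (card (\<Union>R\<in>?S. children R))"
  proof -
    have "root_cube \<notin> (\<Union>R\<in>?S. children R)"
      using children_psubset(4) dyadic_gen_0 by blast
    moreover have "finite (\<Union>R\<in>?S. children R)"
      using S card_children(2) by blast
    ultimately show ?thesis unfolding split_cubes_tree[OF P] by simp
  qed
  also have "card (\<Union>R\<in>?S. children R) = (\<Sum>R\<in>?S. card (children R))"
    using S card_children(2) disjoint_children by (intro card_UN_disjoint) blast+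
  also have "\<dots> = 2 ^ CARD('n) * card ?S"
    using S(3) card_children(1) by (subst sum.cong[OF refl, of _ _ "\<lambda>_. 2 ^ CARD('n)"]) auto
  finally have "card P + card ?S = Suc (2 ^ CARD('n) * card ?S)" .
  \<comment> \<open>This guards against truncation when the factor 2^d - 1 is expanded over the
    natural numbers.\<close>
  moreover have "card ?S \<le> 2 ^ CARD('n) * card ?S" by simp
  ultimately show ?thesis unfolding diff_mult_distrib by linarith
qed

lemma card_split_cubes_le:
  fixes P :: "(real ^ 'n) set set"
  assumes "P \<in> dyadic_partitions" "card P \<le> 1 + (2 ^ CARD('n) - 1) * n"
  shows "card (split_cubes P) \<le> n"
proof -
  \<comment> \<open>The dimension is at least 1, so the factor 2^d - 1 is positive and can be
    cancelled.\<close>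
  have "2 ^ 1 \<le> (2::nat) ^ CARD('n)" by (intro power_increasing) auto
  then show ?thesis using assms by (simp add: card_dyadic_partition)
qed

lemma dyadic_gen_partition: "dyadic_gen k \<in> dyadic_partitions"
  unfolding dyadic_partitions_def partition_on_def disjoint_def
proof (intro CollectI conjI ballI impI)
  show "\<Union>(dyadic_gen k) = root_cube"
    using dyadic_gen_subset_root dyadic_gen_cover by blast
  show "Q \<inter> R = {}" if "Q \<in> dyadic_gen k" "R \<in> dyadic_gen k" "Q \<noteq> R" for Q R
    using dyadic_gen_eqI[OF that(1,2)] that(3) by blast
qed (use finite_dyadic_gen dyadic_genD dyadic_gen_nonempty in blast)+

lemma card_dyadic_gen: "card (dyadic_gen k :: (real ^ 'n) set set) = (2 ^ k) ^ CARD('n)"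
proof -
  have "{m :: 'n \<Rightarrow> nat. \<forall>i. m i < 2 ^ k} = (\<Pi>\<^sub>E i\<in>UNIV. {..<2 ^ k})"
    by (auto simp: PiE_def Pi_def)
  then show ?thesis
    unfolding dyadic_gen_eq card_image[OF inj_on_dyadic_cell] by (simp add: card_PiE)
qed

section \<open>Regular measures and stopping partitions\<close>

lemma dyadic_gen_borel: "Q \<in> dyadic_gen k \<Longrightarrow> Q \<in> sets borel"
proof -
  assume "Q \<in> dyadic_gen k"
  then obtain m where "Q = dyadic_cell k m" unfolding dyadic_gen_eq by auto
  then have "Q = (\<Inter>i. (\<lambda>x. x $ i) -` dyadic_ivl k (m i))"
    by (auto simp: mem_dyadic_cell)
  moreover have "(\<lambda>x. x $ i) -` dyadic_ivl k (m i) \<in> sets borel" for i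
  proof (rule measurable_sets_borel)
    show "(\<lambda>x. x $ i) \<in> borel_measurable borel"
      by (intro borel_measurable_continuous_onI continuous_intros)
    show "dyadic_ivl k (m i) \<in> sets borel" by (simp add: dyadic_ivl_def)
  qed
  ultimately show ?thesis by (simp add: sets.finite_INT)
qed

lemma dyadic_borel: "Q \<in> dyadic \<Longrightarrow> Q \<in> sets borel"
  unfolding dyadic_iff by (rule dyadic_gen_borel)

text \<open>The complement of the support is the union of all open null sets. By the Lindelof
  property countably many of them have the same union, which is therefore null.\<close>

lemma AE_msupport:
  fixes M :: "'a :: second_countable_topology measure"
  assumes "sets M = sets borel"
  shows "AE x in M. x \<in> msupport M"
proof -
  let ?F = "{U. open U \<and> emeasure M U = 0}"
  obtain F where F: "F \<subseteq> ?F" "countable F" "\<Union>F = \<Union>?F"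
    using Lindelof[of ?F] by auto
  have "(\<Union>U\<in>F. U) \<in> null_sets M"
    using F(1,2) assms by (intro null_sets_UN') (auto simp: null_sets_def)
  then have "AE x in M. x \<notin> \<Union>?F" using F(3) by (auto dest: AE_not_in)
  then show ?thesis by (rule AE_mp) (auto simp: msupport_def zero_less_iff_neq_zero)
qed

locale regular_measure =
  fixes \<nu> :: "(real ^ 'n) measure" and a C :: real
  assumes a_pos: "a > 0" and C_ge_1: "C \<ge> 1" and regular: "dyadic_regular a C \<nu>"
begin

sublocale prob_space \<nu>
  using regular by (simp add: dyadic_regular_def)

lemma sets_nu: "sets \<nu> = sets borel"
  using regular by (simp add: dyadic_regular_def)

lemma dyadic_sets [simp]: "Q \<in> dyadic \<Longrightarrow> Q \<in> sets \<nu>"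
  by (simp add: sets_nu dyadic_borel)

lemma measure_dyadic_gen_le: "Q \<in> dyadic_gen k \<Longrightarrow> measure \<nu> Q \<le> C * 2 powr (- a * real k)"
  using regular by (simp add: dyadic_regular_def)

lemma AE_root: "AE x in \<nu>. x \<in> root_cube"
proof -
  have "msupport \<nu> \<subseteq> root_cube"
    using regular interior_subset unfolding dyadic_regular_def by blast
  with AE_msupport[OF sets_nu] show ?thesis by (auto elim: AE_mp)
qed

lemma measure_root: "measure \<nu> root_cube = 1"
  using AE_root prob_eq_1[of root_cube] dyadic_sets[OF root_cube_dyadic(1)] by simp

lemma measure_dyadic_mono: "Q \<subseteq> R \<Longrightarrow> R \<in> dyadic \<Longrightarrow> measure \<nu> Q \<le> measure \<nu> R"
  by (rule finite_measure_mono) auto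

lemma sum_measure_disjoint:
  assumes "finite F" "F \<subseteq> dyadic" "\<And>Q R x. Q \<in> F \<Longrightarrow> R \<in> F \<Longrightarrow> x \<in> Q \<Longrightarrow> x \<in> R \<Longrightarrow> Q = R"
  shows "(\<Sum>Q\<in>F. measure \<nu> Q) = measure \<nu> (\<Union>F)"
proof -
  have "disjoint_family_on (\<lambda>Q. Q) F" unfolding disjoint_family_on_def using assms(3) by blast
  moreover have "F \<subseteq> sets \<nu>" using assms(2) dyadic_sets by blast
  ultimately show ?thesis
    using finite_measure_finite_Union[of F "\<lambda>Q. Q"] assms(1) by simp
qed

lemma part_cost_split:
  assumes P: "P \<in> dyadic_partitions"
  shows "part_cost \<nu> P = (\<Sum>R\<in>split_cubes P. measure \<nu> R)"
proof -
  let ?S = "split_cubes P"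
  note D = dyadic_partitionsD[OF P]
  have "part_cost \<nu> P = (\<Sum>Q\<in>P. \<Sum>R\<in>?S. if Q \<subset> R then measure \<nu> Q else 0)"
    unfolding part_cost_def
  proof (rule sum.cong[OF refl])
    fix Q assume Q: "Q \<in> P"
    \<comment> \<open>All strict dyadic ancestors of a member are split cubes by definition, so none
      is missed when \<open>gen Q\<close> is counted inside \<open>split_cubes P\<close>.\<close>
    have "?S \<inter> {R. Q \<subset> R} = {R \<in> dyadic. Q \<subset> R}" using Q by (auto simp: split_cubes_def)
    moreover have "card {R \<in> dyadic. Q \<subset> R} = gen Q" using Q D(2) by (intro card_ancestors) blast
    ultimately show "measure \<nu> Q * real (gen Q) = (\<Sum>R\<in>?S. if Q \<subset> R then measure \<nu> Q else 0)"
      by (simp add: sum.If_cases finite_split_cubes[OF P])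
  qed
  also have "\<dots> = (\<Sum>R\<in>?S. \<Sum>Q\<in>P. if Q \<subset> R then measure \<nu> Q else 0)"
    by (rule sum.swap)
  also have "\<dots> = (\<Sum>R\<in>?S. measure \<nu> R)"
  proof (rule sum.cong[OF refl])
    fix R assume R: "R \<in> ?S"
    then have Rd: "R \<in> dyadic" by (simp add: split_cubes_def)
    \<comment> \<open>A member that meets the split cube \<open>R\<close> is comparable with it, but
      it neither equals nor contains \<open>R\<close>. So the members strictly inside
      \<open>R\<close> tile it, and their masses add up to that of \<open>R\<close>.\<close>
    have "\<Union>{Q \<in> P. Q \<subset> R} = R"
    proof (rule antisym)
      show "R \<subseteq> \<Union>{Q \<in> P. Q \<subset> R}"
      proof
        fix x assume x: "x \<in> R"
        then obtain Q where Q: "Q \<in> P" "x \<in> Q" using D(3) dyadic_subset_root[OF Rd] by blast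
        have Qd: "Q \<in> dyadic" using Q D(2) by blast
        have "Q \<noteq> R" using split_cubes_disjoint[OF P] Q R by blast
        moreover have "\<not> R \<subset> Q"
          using split_cubes_disjoint[OF P] Q(1) Qd R unfolding split_cubes_def by blast
        ultimately have "Q \<subset> R"
          using dyadic_nested[OF Qd Rd _ Q(2) x] dyadic_nested[OF Rd Qd _ x Q(2)]
          by (cases "gen R \<le> gen Q") auto
        then show "x \<in> \<Union>{Q \<in> P. Q \<subset> R}" using Q by blast
      qed
    qed blast
    moreover have "(\<Sum>Q | Q \<in> P \<and> Q \<subset> R. measure \<nu> Q) = measure \<nu> (\<Union>{Q \<in> P. Q \<subset> R})"
    proof (rule sum_measure_disjoint)
      show "finite {Q \<in> P. Q \<subset> R}" "{Q \<in> P. Q \<subset> R} \<subseteq> dyadic" using D(1,2) by auto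
    qed (use D(4) in auto)
    ultimately show "(\<Sum>Q\<in>P. if Q \<subset> R then measure \<nu> Q else 0) = measure \<nu> R"
      using D(1) by (simp add: sum.inter_filter)
  qed
  finally show ?thesis .
qed

section \<open>Heavy cubes and the stopping partition\<close>

lemma gen_bound:
  assumes "0 < t" "Q \<in> dyadic" "t \<le> measure \<nu> Q"
  shows "real (gen Q) \<le> (log 2 (1 / t) + log 2 C) / a"
proof -
  have "t \<le> C * 2 powr (- a * real (gen Q))"
    using measure_dyadic_gen_le assms(2,3) dyadic_iff by fastforce
  then have "log 2 t \<le> log 2 (C * 2 powr (- a * real (gen Q)))"
    using assms(1) by simp
  also have "\<dots> = log 2 C - a * real (gen Q)"
    using C_ge_1 by (simp add: log_mult)
  finally show ?thesis
    using a_pos assms(1) by (simp add: log_divide field_simps)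
qed

lemma big_cubes_gen:
  assumes "0 < t"
  shows "big_cubes \<nu> t = (\<Union>k\<in>{..nat \<lfloor>(log 2 (1 / t) + log 2 C) / a\<rfloor>}. {Q \<in> dyadic_gen k. t \<le> measure \<nu> Q})"
proof -
  have "gen Q \<le> nat \<lfloor>(log 2 (1 / t) + log 2 C) / a\<rfloor>" if "Q \<in> dyadic" "t \<le> measure \<nu> Q" for Q
    using gen_bound[OF assms that] by (simp add: le_nat_floor)
  moreover have "Q \<in> dyadic_gen (gen Q)" if "Q \<in> dyadic" for Q :: "(real ^ 'n) set"
    using that by (simp only: dyadic_iff[symmetric])
  ultimately show ?thesis unfolding big_cubes_def using dyadic_genD by fast
qed

lemma finite_big_cubes: "0 < t \<Longrightarrow> finite (big_cubes \<nu> t)"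
  unfolding big_cubes_gen by (auto simp: finite_dyadic_gen)

text \<open>The cubes of one generation are disjoint, so at most 1 / t of them have mass at least
  \<open>t\<close>; \<open>gen_bound\<close> limits the number of generations by
  \<open>Kbound a C t\<close>.\<close>

lemma card_big_cubes:
  assumes "0 < t" "t < 1"
  shows "real (card (big_cubes \<nu> t)) \<le> (1 / t) * Kbound a C t"
proof -
  let ?r = "(log 2 (1 / t) + log 2 C) / a"
  let ?n = "nat \<lfloor>?r\<rfloor>"
  have r: "?r \<ge> 0" using assms C_ge_1 a_pos by (intro divide_nonneg_pos add_nonneg_nonneg) auto
  have *: "real (card {Q \<in> dyadic_gen k. t \<le> measure \<nu> Q}) \<le> 1 / t" for k
  proof -
    let ?F = "{Q \<in> dyadic_gen k. t \<le> measure \<nu> Q}"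
    have "real (card ?F) * t \<le> (\<Sum>Q\<in>?F. measure \<nu> Q)"
      using sum_bounded_below[of ?F t "measure \<nu>"] by simp
    also have "\<dots> = measure \<nu> (\<Union>?F)"
      by (intro sum_measure_disjoint) (auto simp: finite_dyadic_gen dest: dyadic_genD dyadic_gen_eqI)
    also have "\<dots> \<le> 1" by simp
    finally show ?thesis using assms by (simp add: field_simps)
  qed
  have "real (card (big_cubes \<nu> t)) \<le> (\<Sum>k\<in>{..?n}. real (card {Q \<in> dyadic_gen k. t \<le> measure \<nu> Q}))"
    unfolding big_cubes_gen[OF assms(1)] of_nat_sum[symmetric] of_nat_le_iff by (rule card_UN_le) simp
  also have "\<dots> \<le> (\<Sum>k\<in>{..?n}. 1 / t)" by (intro sum_mono *)
  also have "\<dots> = (1 / t) * (1 + real ?n)" by simp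
  also have "\<dots> \<le> (1 / t) * Kbound a C t"
    unfolding Kbound_def using r assms(1) by (intro mult_left_mono add_left_mono) (auto simp: of_nat_floor)
  finally show ?thesis .
qed

lemma big_cubesD: "Q \<in> big_cubes \<nu> t \<Longrightarrow> Q \<in> dyadic \<and> t \<le> measure \<nu> Q"
  by (simp add: big_cubes_def)

text \<open>In this form finiteness is visible: there are finitely many heavy cubes, each with
  finitely many children.\<close>

lemma stop_part_full_children:
  "stop_part_full \<nu> t = (\<Union>R\<in>big_cubes \<nu> t. children R) - big_cubes \<nu> t"
  unfolding stop_part_full_def big_cubes_def children_def using parent_dyadic by auto

lemma stop_part_full_eq:
  assumes "0 < t"
  shows "stop_part_full \<nu> t = stop_part \<nu> t \<union> null_children \<nu> (big_cubes \<nu> t)"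
  unfolding stop_part_full_def stop_part_def null_children_def big_cubes_def
  using assms parent_dyadic zero_less_measure_iff[of \<nu>] by auto

text \<open>Descend through the cubes containing \<open>x\<close> to the first one of mass below
  \<open>t\<close>. It exists because heavy cubes have bounded generation, and it has a parent
  because the root has mass 1 > t.\<close>

lemma stop_part_full_member:
  assumes "0 < t" "t < 1" "x \<in> root_cube"
  obtains Q where "Q \<in> stop_part_full \<nu> t" "x \<in> Q"
proof -
  define B where "B k \<longleftrightarrow> (\<exists>Q \<in> dyadic_gen k. x \<in> Q \<and> measure \<nu> Q < t)" for k
  have "\<exists>k. B k"
  proof (rule ccontr)
    assume "\<nexists>k. B k"
    then have "measure \<nu> Q \<ge> t" if "Q \<in> dyadic_gen k" "x \<in> Q" for Q k
      using that unfolding B_def by (meson not_le)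
    moreover obtain Q where Q: "Q \<in> dyadic_gen (Suc (nat \<lfloor>(log 2 (1 / t) + log 2 C) / a\<rfloor>))" "x \<in> Q"
      using dyadic_gen_cover[OF assms(3)] .
    ultimately have "real (gen Q) \<le> (log 2 (1 / t) + log 2 C) / a"
      using gen_bound[OF assms(1), of Q] dyadic_genD[OF Q(1)] by blast
    then show False using dyadic_genD[OF Q(1)] by linarith
  qed
  then obtain k where k: "B k" "\<And>j. j < k \<Longrightarrow> \<not> B j" by (metis exists_least_iff)
  then obtain Q where Q: "Q \<in> dyadic_gen k" "x \<in> Q" "measure \<nu> Q < t" unfolding B_def by blast
  have "k \<noteq> 0"
  proof
    assume "k = 0"
    then have "Q = root_cube" using Q(1) by (simp add: dyadic_gen_0)
    then show False using Q(3) measure_root assms(2) by simp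
  qed
  then have Q0: "Q \<in> dyadic - dyadic_gen 0"
    using dyadic_genD[OF Q(1)] dyadic_gen_unique[OF Q(1)] by auto
  then obtain j where j: "Q \<in> dyadic_gen (Suc j)" "parent Q \<in> dyadic_gen j" "Q \<subset> parent Q"
    by (rule dyadic_Suc_cases)
  then have "j < k" using dyadic_gen_unique[OF Q(1) j(1)] by simp
  then have "t \<le> measure \<nu> (parent Q)"
    using k(2) j Q(2) unfolding B_def by (meson not_le psubsetD)
  then show ?thesis using that[of Q] Q Q0 by (simp add: stop_part_full_def)
qed

lemma stop_part_full_partition:
  assumes "0 < t" "t < 1"
  shows "stop_part_full \<nu> t \<in> dyadic_partitions"
  unfolding dyadic_partitions_def partition_on_def disjoint_def
proof (intro CollectI conjI ballI impI)
  let ?F = "stop_part_full \<nu> t"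
  have F: "?F \<subseteq> dyadic" by (auto simp: stop_part_full_def)
  then show "?F \<subseteq> dyadic" .
  have "finite (\<Union>R\<in>big_cubes \<nu> t. children R)"
    using finite_big_cubes[OF assms(1)] card_children(2) big_cubesD by blast
  then show "finite ?F" unfolding stop_part_full_children by (rule finite_Diff)
  show "\<Union>?F = root_cube"
    using F dyadic_subset_root stop_part_full_member[OF assms] by blast
  show "{} \<notin> ?F" using F dyadic_nonempty by blast
  show "Q \<inter> Q' = {}" if "Q \<in> ?F" "Q' \<in> ?F" "Q \<noteq> Q'" for Q Q'
  proof -
    \<comment> \<open>If one member were strictly inside another, its parent, of mass at least
      \<open>t\<close>, would lie in the larger member, whose mass is below
      \<open>t\<close>.\<close>
    have *: False if Q: "Q \<in> ?F" "Q' \<in> ?F" "Q' \<subset> Q" for Q Q'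
    proof -
      have "parent Q' \<subseteq> Q" using dyadic_Suc_psubset[of Q' Q] Q by (auto simp: stop_part_full_def)
      then have "measure \<nu> (parent Q') \<le> measure \<nu> Q" using Q F by (intro measure_dyadic_mono) auto
      then show False using Q by (auto simp: stop_part_full_def)
    qed
    show ?thesis
    proof (rule ccontr)
      assume "Q \<inter> Q' \<noteq> {}"
      then obtain x where x: "x \<in> Q" "x \<in> Q'" by blast
      have d: "Q \<in> dyadic" "Q' \<in> dyadic" using that F by auto
      have "Q \<subseteq> Q' \<or> Q' \<subseteq> Q"
        using dyadic_nested[OF d(1,2) _ x] dyadic_nested[OF d(2,1) _ x(2,1)] by (meson nle_le)
      then show False using *[of Q Q'] *[of Q' Q] that by blast
    qed
  qed
qed

text \<open>A cube strictly above a member contains the parent of that member and is heavy.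
  Conversely, a heavy cube cannot lie in a member, whose mass is below \<open>t\<close>, so some
  member lies strictly inside it.\<close>

lemma split_cubes_stop_part:
  assumes "0 < t" "t < 1"
  shows "split_cubes (stop_part_full \<nu> t) = big_cubes \<nu> t"
proof (intro set_eqI iffI)
  fix Q assume "Q \<in> split_cubes (stop_part_full \<nu> t)"
  then obtain R where R: "Q \<in> dyadic" "R \<in> stop_part_full \<nu> t" "R \<subset> Q"
    unfolding split_cubes_def by blast
  then have "parent R \<subseteq> Q" using dyadic_Suc_psubset[of R Q] by (auto simp: stop_part_full_def)
  then have "measure \<nu> (parent R) \<le> measure \<nu> Q" using R by (intro measure_dyadic_mono)
  then show "Q \<in> big_cubes \<nu> t" using R by (auto simp: stop_part_full_def big_cubes_def)
next
  fix Q assume Q: "Q \<in> big_cubes \<nu> t"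
  then have Qd: "Q \<in> dyadic" using big_cubesD by blast
  obtain R where R: "R \<in> stop_part_full \<nu> t" "R \<subseteq> Q \<or> Q \<subset> R"
    using dyadic_partitions_member[OF stop_part_full_partition[OF assms] Qd] .
  have "\<not> Q \<subseteq> R"
  proof
    assume "Q \<subseteq> R"
    then have "measure \<nu> Q \<le> measure \<nu> R"
      using R(1) by (intro measure_dyadic_mono) (auto simp: stop_part_full_def)
    then show False using Q R(1) by (auto simp: stop_part_full_def big_cubes_def)
  qed
  then show "Q \<in> split_cubes (stop_part_full \<nu> t)"
    using R Qd unfolding split_cubes_def by blast
qed

lemma card_stop_part_full:
  assumes "0 < t" "t < 1"
  shows "card (stop_part_full \<nu> t) = Nt \<nu> t"
  using card_dyadic_partition[OF stop_part_full_partition[OF assms]]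
  unfolding split_cubes_stop_part[OF assms] Nt_def .

lemma stop_card_le:
  assumes "0 < t" "t < 1"
  shows "stop_card \<nu> t \<le> Nt \<nu> t"
  unfolding stop_card_def card_stop_part_full[OF assms, symmetric]
  using dyadic_partitionsD(1)[OF stop_part_full_partition[OF assms]]
  by (intro card_mono) (auto simp: stop_part_full_eq[OF assms(1)])

lemma part_cost_stop_part:
  assumes "0 < t" "t < 1"
  shows "part_cost \<nu> (stop_part_full \<nu> t) = stop_cost \<nu> t"
proof -
  have "part_cost \<nu> (stop_part_full \<nu> t) = (\<Sum>Q\<in>stop_part \<nu> t. measure \<nu> Q * real (gen Q))"
    unfolding part_cost_def
  proof (rule sum.mono_neutral_right)
    show "finite (stop_part_full \<nu> t)"
      using dyadic_partitionsD(1)[OF stop_part_full_partition[OF assms]] .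
  qed (auto simp: stop_part_full_eq[OF assms(1)] null_children_def)
  then show ?thesis
    unfolding stop_cost_def side_def by (simp add: sum_negf)
qed

lemma stop_cost_eq:
  assumes "0 < t" "t < 1"
  shows "stop_cost \<nu> t = (\<Sum>Q\<in>big_cubes \<nu> t. measure \<nu> Q)"
  using part_cost_split[OF stop_part_full_partition[OF assms]]
  by (simp add: part_cost_stop_part[OF assms] split_cubes_stop_part[OF assms])

section \<open>Optimality of stopping partitions and growth of \<open>Gam\<close>\<close>

lemma part_cost_le_stop_cost:
  assumes "0 < t" "t < 1" "P \<in> dyadic_partitions" "card P \<le> Nt \<nu> t"
  shows "part_cost \<nu> P \<le> stop_cost \<nu> t"
proof -
  let ?S = "split_cubes P" and ?B = "big_cubes \<nu> t"
  have fin: "finite ?S" "finite ?B"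
    using finite_split_cubes assms finite_big_cubes by auto
  have "card ?S \<le> card ?B"
    using card_split_cubes_le[OF assms(3)] assms(4) unfolding Nt_def .
  then have card: "card (?S - ?B) \<le> card (?B - ?S)"
    by (metis card_le_sym_Diff fin)
  have "(\<Sum>Q\<in>?S - ?B. measure \<nu> Q) \<le> real (card (?S - ?B)) * t"
    by (rule sum_bounded_above) (auto simp: big_cubes_def split_cubes_def)
  also have "\<dots> \<le> real (card (?B - ?S)) * t"
    using card assms(1) by (intro mult_right_mono) auto
  also have "\<dots> \<le> (\<Sum>Q\<in>?B - ?S. measure \<nu> Q)"
    by (rule sum_bounded_below) (auto simp: big_cubes_def)
  finally have "(\<Sum>Q\<in>?S \<inter> ?B. measure \<nu> Q) + (\<Sum>Q\<in>?S - ?B. measure \<nu> Q)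
      \<le> (\<Sum>Q\<in>?B \<inter> ?S. measure \<nu> Q) + (\<Sum>Q\<in>?B - ?S. measure \<nu> Q)"
    by (simp add: Int_commute)
  then show ?thesis
    unfolding stop_cost_eq[OF assms(1,2)] part_cost_split[OF assms(3)]
    by (simp add: sum.Int_Diff[OF fin(1), of _ ?B, symmetric] sum.Int_Diff[OF fin(2), of _ ?S, symmetric])
qed

lemma Gam_Nt:
  assumes "0 < t" "t < 1"
  shows "Gam \<nu> (Nt \<nu> t) = stop_cost \<nu> t"
  unfolding Gam_def
proof (rule cSup_eq_maximum)
  show "stop_cost \<nu> t \<in> part_cost \<nu> ` {P \<in> dyadic_partitions. card P \<le> Nt \<nu> t}"
    using stop_part_full_partition[OF assms] card_stop_part_full[OF assms] part_cost_stop_part[OF assms]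
    by (metis (mono_tags, lifting) imageI mem_Collect_eq order_refl)
qed (use part_cost_le_stop_cost[OF assms] in auto)

text \<open>A crude bound, whose purpose is that the supremum in \<open>Gam\<close> is taken over a
  bounded set.\<close>

lemma part_cost_le_card:
  assumes "P \<in> dyadic_partitions"
  shows "part_cost \<nu> P \<le> real (card P)"
proof -
  have "part_cost \<nu> P \<le> (\<Sum>Q\<in>split_cubes P. 1)"
    unfolding part_cost_split[OF assms] by (intro sum_mono) simp
  also have "\<dots> = real (card (split_cubes P))" by simp
  also have "\<dots> \<le> real (card P)"
  proof -
    have "2 ^ 1 \<le> (2::nat) ^ CARD('n)" by (intro power_increasing) auto
    then have "1 * card (split_cubes P) \<le> (2 ^ CARD('n) - 1) * card (split_cubes P)"
      by (intro mult_le_mono1) simp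
    then show ?thesis unfolding card_dyadic_partition[OF assms] of_nat_le_iff by linarith
  qed
  finally show ?thesis .
qed

lemma bdd_above_part_cost: "bdd_above (part_cost \<nu> ` {P \<in> dyadic_partitions. card P \<le> N})"
proof (rule bdd_aboveI2)
  fix P :: "(real ^ 'n) set set" assume "P \<in> {P \<in> dyadic_partitions. card P \<le> N}"
  then show "part_cost \<nu> P \<le> real N" using part_cost_le_card[of P] by auto
qed

lemma part_cost_le_Gam: "P \<in> dyadic_partitions \<Longrightarrow> card P \<le> N \<Longrightarrow> part_cost \<nu> P \<le> Gam \<nu> N"
  unfolding Gam_def by (rule cSUP_upper[OF _ bdd_above_part_cost]) simp

lemma partitions_nonempty:
  assumes "1 \<le> N"
  shows "{P :: (real ^ 'n) set set. P \<in> dyadic_partitions \<and> card P \<le> N} \<noteq> {}"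
  using dyadic_gen_partition[of 0] assms by (auto simp: dyadic_gen_0 intro!: exI[of _ "{root_cube}"])

lemma Gam_mono:
  assumes "1 \<le> M" "M \<le> N"
  shows "Gam \<nu> M \<le> Gam \<nu> N"
  unfolding Gam_def
  by (rule cSUP_subset_mono[OF partitions_nonempty[OF assms(1)] bdd_above_part_cost]) (use assms in auto)

text \<open>The uniform partition into the cubes of generation \<open>k\<close> has cost
  \<open>k\<close>. As a competitor it forces \<open>Gam\<close> to tend to infinity.\<close>

lemma Gam_ge:
  assumes "(2 ^ k) ^ CARD('n) \<le> N"
  shows "real k \<le> Gam \<nu> N"
proof -
  have "part_cost \<nu> (dyadic_gen k) = (\<Sum>Q\<in>dyadic_gen k. measure \<nu> Q) * real k"
    unfolding part_cost_def sum_distrib_right by (intro sum.cong) (auto simp: gen_eq)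
  also have "(\<Sum>Q\<in>dyadic_gen k. measure \<nu> Q) = measure \<nu> (\<Union>(dyadic_gen k))"
    by (intro sum_measure_disjoint)
      (use dyadic_partitionsD(1,2)[OF dyadic_gen_partition[of k]] dyadic_gen_eqI in blast)+
  also have "\<dots> = 1"
    unfolding dyadic_partitionsD(3)[OF dyadic_gen_partition[of k]] by (rule measure_root)
  finally show ?thesis
    using part_cost_le_Gam[OF dyadic_gen_partition[of k]] assms by (simp add: card_dyadic_gen)
qed

end

section \<open>Quantization error\<close>

lemma eln_mono: "x \<le> y \<Longrightarrow> eln x \<le> eln y"
  by (cases x; cases y) (auto simp: eln_def)

lemma eln_ereal: "0 < r \<Longrightarrow> eln (ereal r) = ereal (ln r)"
  by (simp add: eln_def)

lemma eexp_mono: "x \<le> y \<Longrightarrow> eexp x \<le> eexp y"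
  by (cases x; cases y) (auto simp: eexp_def)

lemma elog2_mono: "x \<le> y \<Longrightarrow> elog2 x \<le> elog2 y"
  unfolding elog2_def using eln_mono by (intro ereal_divide_right_mono) auto

text \<open>The factor \<open>ln 2\<close> converts between the natural logarithm under the integral
  and the base 2 in which costs are measured.\<close>

lemma elog2_exp: "elog2 (ereal (exp (- (ln 2 * L)))) = ereal (- L)"
  by (simp add: elog2_def eln_ereal)

lemma Bq_ge:
  assumes "quant_err0 \<nu> N \<le> ereal (exp (- (ln 2 * L)))"
  shows "ereal L \<le> Bq \<nu> N"
  using elog2_mono[OF assms] unfolding elog2_exp Bq_def
  by (metis ereal_minus_le_minus ereal_uminus_uminus uminus_ereal.simps(1))

lemma Bq_le:
  assumes "ereal (exp (- (ln 2 * L))) \<le> quant_err0 \<nu> N"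
  shows "Bq \<nu> N \<le> ereal L"
  using elog2_mono[OF assms] unfolding elog2_exp Bq_def
  by (simp flip: uminus_ereal.simps add: ereal_uminus_le_reorder)

lemma eexp_ereal: "eexp (ereal r) = ereal (exp r)"
  by (simp add: eexp_def)

lemma infnorm_le:
  fixes x :: "real ^ 'n"
  assumes "\<And>i. \<bar>x $ i\<bar> \<le> r"
  shows "infnorm x \<le> r"
  unfolding infnorm_cart using assms by (intro cSup_least) auto

lemma dyadic_gen_diam:
  assumes "Q \<in> dyadic_gen k" "x \<in> Q" "y \<in> Q"
  shows "infnorm (x - y) \<le> 1 / 2 ^ k"
proof (rule infnorm_le)
  fix i
  obtain m where m: "\<forall>i. m i < 2 ^ k" "Q = dyadic_cell k m"
    using assms(1) unfolding dyadic_gen_eq by auto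
  then show "\<bar>(x - y) $ i\<bar> \<le> 1 / 2 ^ k"
    using dyadic_ivl_diam[of "m i" k "x $ i" "y $ i"] assms(2,3) by (simp add: mem_dyadic_cell)
qed

lemma max_dist_le:
  assumes "y \<in> A"
  shows "max_dist x A \<le> infnorm (x - y)"
  unfolding max_dist_def
  by (rule cINF_lower[OF _ assms]) (auto intro!: bdd_belowI[of _ 0] infnorm_pos_le)

lemma max_dist_attained:
  assumes "finite A" "A \<noteq> {}"
  obtains y where "y \<in> A" "max_dist x A = infnorm (x - y)"
proof -
  let ?I = "(\<lambda>y. infnorm (x - y)) ` A"
  have "Inf ?I \<in> ?I"
    using assms by (subst cInf_eq_Min) auto
  then show ?thesis using that unfolding max_dist_def by blast
qed

text \<open>The number of \<open>k\<close> with \<open>d < 1 / 2 ^ k\<close> is at least \<open>- log 2 d\<close>, and infinite if \<open>d \<le> 0\<close>.\<close>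
lemma neg_eln_le_suminf:
  fixes d :: real
  shows "e2ennreal (- eln (ereal d)) \<le> (\<Sum>k. ennreal (ln 2) * indicator {k. d < 1 / 2 ^ k} k)" (is "_ \<le> suminf ?f")
proof -
  have *: "ennreal (ln 2 * real n) \<le> suminf ?f" if "\<And>k. k < n \<Longrightarrow> d < 1 / 2 ^ k" for n
  proof -
    have "ennreal (ln 2 * real n) = (\<Sum>k<n. ennreal (ln 2))"
      by (simp add: ennreal_mult' ennreal_of_nat_eq_real_of_nat mult.commute)
    also have "\<dots> = sum ?f {..<n}"
      using that by (intro sum.cong) auto
    also have "\<dots> \<le> suminf ?f" by (rule sum_le_suminf) auto
    finally show ?thesis .
  qed
  show ?thesis
  proof (cases "d \<le> 0")
    case True
    have "d < 1 / 2 ^ k" for k :: nat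
      using True by (rule le_less_trans) simp
    then have le: "ennreal (ln 2 * real n) \<le> suminf ?f" for n
      by (intro *)
    have "suminf ?f = top"
    proof (rule ccontr)
      assume "suminf ?f \<noteq> top"
      then obtain r where r: "0 \<le> r" "suminf ?f = ennreal r" by (cases "suminf ?f") auto
      obtain n where "r < real n * ln 2"
        using ex_less_of_nat_mult[of "ln 2" r] by auto
      then show False using le[of n] r by (simp add: mult.commute)
    qed
    then show ?thesis by simp
  next
    case False
    \<comment> \<open>For d >= 1 this is 0, which fits because the left-hand side is then truncated
      to 0 by \<open>e2ennreal\<close>.\<close>
    define n where "n = nat \<lceil>- log 2 d\<rceil>"
    have "d < 1 / 2 ^ k" if "k < n" for k
    proof -
      have "real k < - log 2 d" using that unfolding n_def by linarith
      then have "log 2 d < - real k" by simp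
      then have "d < 2 powr (- real k)" using False by (simp add: log_less_iff)
      then show ?thesis by (simp add: powr_minus powr_realpow divide_inverse)
    qed
    then have "ennreal (ln 2 * real n) \<le> suminf ?f" by (rule *)
    moreover have "e2ennreal (- eln (ereal d)) \<le> ennreal (ln 2 * real n)"
    proof -
      have "ln 2 * (- log 2 d) \<le> ln 2 * real n"
        unfolding n_def by (intro mult_left_mono real_nat_ceiling_ge) auto
      moreover have "ln 2 * (- log 2 d) = - ln d" by (simp add: log_def)
      ultimately show ?thesis using False by (simp add: eln_ereal ennreal_leI)
    qed
    ultimately show ?thesis by (rule order_trans[rotated])
  qed
qed

text \<open>The radius equals the side length, so that the number of cubes per point of
  \<open>A\<close> is bounded independently of \<open>k\<close>.\<close>

definition near_cubes :: "(real ^ 'n) set \<Rightarrow> nat \<Rightarrow> (real ^ 'n) set set" where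
  "near_cubes A k = {Q \<in> dyadic_gen k. \<exists>y\<in>A. \<exists>x\<in>Q. infnorm (x - y) < 1 / 2 ^ k}"

lemma finite_near_cubes: "finite (near_cubes A k)"
  unfolding near_cubes_def by (simp add: finite_dyadic_gen)

text \<open>Put r = y $ i * 2^k. The scaled coordinate of a point of the cube lies between m i and m
  i + 1 and within distance less than 1 of r, so r - 2 < m i < r + 1. An open interval of length 3
  contains at most three integers.\<close>

lemma card_near_cubes_point:
  fixes y :: "real ^ 'n"
  shows "card (near_cubes {y} k) \<le> 3 ^ CARD('n)"
proof -
  define S where "S r = {m :: nat. r - 2 < real m \<and> real m < r + 1}" for r
  have S: "finite (S r)" "card (S r) \<le> 3" for r
  proof -
    have "S r \<subseteq> nat ` {\<lfloor>r\<rfloor> - 1..\<lfloor>r\<rfloor> + 1}"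
    proof
      fix m assume "m \<in> S r"
      then have "int m \<in> {\<lfloor>r\<rfloor> - 1..\<lfloor>r\<rfloor> + 1}" unfolding S_def by (simp, linarith)
      then show "m \<in> nat ` {\<lfloor>r\<rfloor> - 1..\<lfloor>r\<rfloor> + 1}" by (intro image_eqI[of _ _ "int m"]) auto
    qed
    moreover have "card (nat ` {\<lfloor>r\<rfloor> - 1..\<lfloor>r\<rfloor> + 1}) \<le> 3"
      using card_image_le[of "{\<lfloor>r\<rfloor> - 1..\<lfloor>r\<rfloor> + 1}" nat] by simp
    ultimately show "finite (S r)" "card (S r) \<le> 3"
      using card_mono[of "nat ` {\<lfloor>r\<rfloor> - 1..\<lfloor>r\<rfloor> + 1}" "S r"] finite_subset by auto
  qed
  let ?M = "\<Pi>\<^sub>E i\<in>UNIV. S (y $ i * 2 ^ k)"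
  have "near_cubes {y} k \<subseteq> dyadic_cell k ` ?M"
  proof
    fix Q assume "Q \<in> near_cubes {y} k"
    then obtain m x where m: "\<forall>i. m i < 2 ^ k" "Q = dyadic_cell k m" and x: "x \<in> Q" "infnorm (x - y) < 1 / 2 ^ k"
      unfolding near_cubes_def dyadic_gen_eq by auto
    have "m i \<in> S (y $ i * 2 ^ k)" for i
    proof -
      have "\<bar>x $ i - y $ i\<bar> < 1 / 2 ^ k"
        using component_le_infnorm_cart[of "x - y" i] x(2) by simp
      then have "\<bar>x $ i - y $ i\<bar> * 2 ^ k < 1" by (simp add: field_simps)
      then have "\<bar>x $ i * 2 ^ k - y $ i * 2 ^ k\<bar> < 1"
        by (metis abs_mult abs_numeral left_diff_distrib power_abs)
      moreover have "real (m i) \<le> x $ i * 2 ^ k" "x $ i * 2 ^ k \<le> real (m i) + 1"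
      proof -
        have "x $ i \<in> dyadic_ivl k (m i)" using x(1) m(2) by (simp add: mem_dyadic_cell)
        then have *: "real (m i) \<le> x $ i * 2 ^ k"
            "x $ i * 2 ^ k < real (m i) + 1 \<or> x $ i = 1 \<and> Suc (m i) = 2 ^ k"
          using mem_dyadic_ivl m(1) by blast+
        show "real (m i) \<le> x $ i * 2 ^ k" by (rule *(1))
        show "x $ i * 2 ^ k \<le> real (m i) + 1"
          using *(2)
        proof
          assume "x $ i = 1 \<and> Suc (m i) = 2 ^ k"
          then have "real (Suc (m i)) = x $ i * 2 ^ k" by simp
          then show ?thesis by simp
        qed simp
      qed
      ultimately show ?thesis unfolding S_def by (intro CollectI conjI) linarith+
    qed
    then have "m \<in> ?M" by (simp add: PiE_UNIV_domain)
    with m(2) show "Q \<in> dyadic_cell k ` ?M" by blast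
  qed
  then have "card (near_cubes {y} k) \<le> card (dyadic_cell k ` ?M)"
    by (intro card_mono finite_imageI finite_PiE S) auto
  also have "\<dots> \<le> card ?M" by (intro card_image_le finite_PiE S) auto
  also have "\<dots> = (\<Prod>i\<in>(UNIV :: 'n set). card (S (y $ i * 2 ^ k)))" by (simp add: card_PiE)
  also have "\<dots> \<le> (\<Prod>i\<in>(UNIV :: 'n set). 3)" by (intro prod_mono) (simp add: S(2))
  finally show ?thesis by simp
qed

lemma card_near_cubes:
  fixes A :: "(real ^ 'n) set"
  assumes "finite A"
  shows "card (near_cubes A k) \<le> 3 ^ CARD('n) * card A"
proof -
  have "near_cubes A k = (\<Union>y\<in>A. near_cubes {y} k)"
    unfolding near_cubes_def by blast
  then have "card (near_cubes A k) \<le> (\<Sum>y\<in>A. card (near_cubes {y} k))"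
    using card_UN_le[OF assms] by simp
  also have "\<dots> \<le> (\<Sum>y\<in>A. 3 ^ CARD('n))" by (intro sum_mono card_near_cubes_point)
  finally show ?thesis by (simp add: mult.commute)
qed

lemma near_cubes_cover:
  assumes "finite A" "A \<noteq> {}" "x \<in> root_cube" "max_dist x A < 1 / 2 ^ k"
  shows "x \<in> \<Union>(near_cubes A k)"
proof -
  obtain y where y: "y \<in> A" "max_dist x A = infnorm (x - y)"
    using max_dist_attained[OF assms(1,2)] .
  obtain Q where Q: "Q \<in> dyadic_gen k" "x \<in> Q" using dyadic_gen_cover[OF assms(3)] .
  show ?thesis unfolding near_cubes_def using y Q assms(4) by auto
qed

section \<open>The two bounds for the quantization error\<close>

context regular_measure
begin

text \<open>Each member \<open>Q\<close> contains a point of \<open>A\<close>, so on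
  \<open>Q\<close> the distance to \<open>A\<close> is at most the side length of
  \<open>Q\<close>.\<close>

lemma eintegral_le_part_cost:
  assumes P: "P \<in> dyadic_partitions" and A: "\<And>Q. Q \<in> P \<Longrightarrow> A \<inter> Q \<noteq> {}"
  shows "eintegral \<nu> (\<lambda>x. eln (ereal (max_dist x A))) \<le> ereal (- (ln 2 * part_cost \<nu> P))"
proof -
  note D = dyadic_partitionsD[OF P]
  let ?f = "\<lambda>x. eln (ereal (max_dist x A))"
  have f: "?f x \<le> ereal (- (ln 2 * real (gen Q)))" if Q: "Q \<in> P" "x \<in> Q" for x Q
  proof -
    obtain y where y: "y \<in> A" "y \<in> Q" using A[OF Q(1)] by blast
    have "max_dist x A \<le> infnorm (x - y)" by (rule max_dist_le[OF y(1)])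
    also have "\<dots> \<le> 1 / 2 ^ gen Q"
      using dyadic_gen_diam[of Q "gen Q" x y] Q y D(2) dyadic_iff by blast
    finally have "?f x \<le> eln (ereal (1 / 2 ^ gen Q))" by (intro eln_mono) simp
    also have "\<dots> = ereal (- (ln 2 * real (gen Q)))"
      by (simp add: eln_ereal ln_div ln_realpow)
    finally show ?thesis .
  qed
  \<comment> \<open>Side lengths are at most 1, so the integrand has no positive part and only its
    negative part has to be estimated.\<close>
  have "AE x in \<nu>. e2ennreal (?f x) = 0"
  proof (rule AE_mp[OF AE_root], rule AE_I2, rule impI)
    fix x :: "real ^ 'n" assume "x \<in> root_cube"
    then obtain Q where "Q \<in> P" "x \<in> Q" using D(3) by blast
    then have "?f x \<le> ereal (- (ln 2 * real (gen Q)))" by (rule f)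
    also have "\<dots> \<le> 0" by simp
    finally show "e2ennreal (?f x) = 0" by (rule e2ennreal_neg)
  qed
  then have "(\<integral>\<^sup>+ x. e2ennreal (?f x) \<partial>\<nu>) = (\<integral>\<^sup>+ x. 0 \<partial>\<nu>)" by (rule nn_integral_cong_AE)
  then have 1: "(\<integral>\<^sup>+ x. e2ennreal (?f x) \<partial>\<nu>) = 0" by simp
  have "ennreal (ln 2 * part_cost \<nu> P) = (\<Sum>Q\<in>P. ennreal (ln 2 * real (gen Q)) * emeasure \<nu> Q)"
    unfolding part_cost_def sum_distrib_left emeasure_eq_measure
    by (subst sum_ennreal[symmetric]) (auto simp: ennreal_mult'[symmetric] mult_ac intro!: sum.cong)
  also have "\<dots> = (\<integral>\<^sup>+ x. (\<Sum>Q\<in>P. ennreal (ln 2 * real (gen Q)) * indicator Q x) \<partial>\<nu>)"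
  proof (subst nn_integral_sum)
    show "(\<lambda>x. ennreal (ln 2 * real (gen Q)) * indicator Q x) \<in> borel_measurable \<nu>" if "Q \<in> P" for Q
      using that D(2) dyadic_sets[of Q] by (intro borel_measurable_times_ennreal borel_measurable_indicator) auto
    show "(\<Sum>Q\<in>P. ennreal (ln 2 * real (gen Q)) * emeasure \<nu> Q)
        = (\<Sum>Q\<in>P. \<integral>\<^sup>+ x. ennreal (ln 2 * real (gen Q)) * indicator Q x \<partial>\<nu>)"
      using D(2) dyadic_sets by (intro sum.cong) (auto simp: nn_integral_cmult_indicator subset_iff)
  qed
  also have "\<dots> \<le> (\<integral>\<^sup>+ x. e2ennreal (- ?f x) \<partial>\<nu>)"
  proof (rule nn_integral_mono_AE, rule AE_mp[OF AE_root], rule AE_I2, rule impI)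
    fix x :: "real ^ 'n" assume "x \<in> root_cube"
    then obtain Q where Q: "Q \<in> P" "x \<in> Q" using D(3) by blast
    \<comment> \<open>By disjointness only the summand of the member containing \<open>x\<close>
      survives.\<close>
    have "x \<notin> R" if "R \<in> P - {Q}" for R
      using D(4)[of Q R x] that Q by auto
    then have "(\<Sum>R\<in>P. ennreal (ln 2 * real (gen R)) * indicator R x)
        = (\<Sum>R\<in>{Q}. ennreal (ln 2 * real (gen R)) * indicator R x)"
      using Q(1) D(1) by (intro sum.mono_neutral_right) simp_all
    also have "\<dots> = e2ennreal (ereal (ln 2 * real (gen Q)))" using Q by simp
    also have "\<dots> \<le> e2ennreal (- ?f x)"
    proof (rule e2ennreal_mono)
      have "- ereal (- (ln 2 * real (gen Q))) \<le> - ?f x"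
        using f[OF Q] by (simp only: ereal_minus_le_minus)
      then show "ereal (ln 2 * real (gen Q)) \<le> - ?f x" by simp
    qed
    finally show "(\<Sum>Q\<in>P. ennreal (ln 2 * real (gen Q)) * indicator Q x) \<le> e2ennreal (- ?f x)" .
  qed
  finally have 2: "ennreal (ln 2 * part_cost \<nu> P) \<le> (\<integral>\<^sup>+ x. e2ennreal (- ?f x) \<partial>\<nu>)" .
  have "0 \<le> part_cost \<nu> P" unfolding part_cost_def by (intro sum_nonneg) auto
  then have "ereal (ln 2 * part_cost \<nu> P) \<le> enn2ereal (\<integral>\<^sup>+ x. e2ennreal (- ?f x) \<partial>\<nu>)"
    using 2 by (metis enn2ereal_ennreal less_eq_ennreal.rep_eq ln_ge_zero mult_nonneg_nonneg one_le_numeral)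
  then show ?thesis
    unfolding eintegral_def 1 by (simp add: zero_ennreal.rep_eq ereal_uminus_le_reorder flip: uminus_ereal.simps)
qed

lemma part_cost_le_Bq:
  assumes P: "P \<in> dyadic_partitions" "card P \<le> N"
  shows "ereal (part_cost \<nu> P) \<le> Bq \<nu> N"
proof (rule Bq_ge)
  note D = dyadic_partitionsD[OF P(1)]
  have ne: "Q \<noteq> {}" if "Q \<in> P" for Q using that D(2) dyadic_nonempty by blast
  define p where "p Q = (SOME x. x \<in> Q)" for Q :: "(real ^ 'n) set"
  have p: "p Q \<in> Q" if "Q \<in> P" for Q using ne[OF that] unfolding p_def by (rule some_in_eq[THEN iffD2])
  have "P \<noteq> {}" using D(3) dyadic_nonempty[OF root_cube_dyadic(1)] by blast
  then have "1 \<le> card (p ` P)" using D(1) by (simp add: Suc_le_eq card_gt_0_iff)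
  moreover have "card (p ` P) \<le> N" using card_image_le[OF D(1), of p] P(2) by simp
  ultimately have "p ` P \<in> {A. finite A \<and> 1 \<le> card A \<and> card A \<le> N}" using D(1) by simp
  then show "quant_err0 \<nu> N \<le> ereal (exp (- (ln 2 * part_cost \<nu> P)))"
    unfolding quant_err0_def
  proof (rule INF_lower2)
    have "eintegral \<nu> (\<lambda>x. eln (ereal (max_dist x (p ` P)))) \<le> ereal (- (ln 2 * part_cost \<nu> P))"
      using p by (intro eintegral_le_part_cost[OF P(1)]) blast
    then show "eexp (eintegral \<nu> (\<lambda>x. eln (ereal (max_dist x (p ` P))))) \<le> ereal (exp (- (ln 2 * part_cost \<nu> P)))"
      using eexp_mono unfolding eexp_ereal[symmetric] by blast
  qed
qed

lemma Gam_le_Bq: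
  assumes "1 \<le> N"
  shows "ereal (Gam \<nu> N) \<le> Bq \<nu> N"
proof (cases "Bq \<nu> N")
  \<comment> \<open>\<open>Bq\<close> is extended real and \<open>Gam\<close> a real supremum. The
    bound for each partition passes to the supremum when \<open>Bq \<nu> N\<close> is finite; the
    value minus infinity is excluded by any single partition.\<close>
  case (real b)
  have "Gam \<nu> N \<le> b"
    unfolding Gam_def
  proof (rule cSUP_least[OF partitions_nonempty[OF assms]])
    fix P :: "(real ^ 'n) set set" assume "P \<in> {P. P \<in> dyadic_partitions \<and> card P \<le> N}"
    then show "part_cost \<nu> P \<le> b" using part_cost_le_Bq[of P N] real by simp
  qed
  then show ?thesis using real by simp
next
  case MInf
  obtain P :: "(real ^ 'n) set set" where "P \<in> dyadic_partitions" "card P \<le> N"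
    using partitions_nonempty[OF assms] by blast
  then show ?thesis using part_cost_le_Bq MInf by fastforce
qed simp

text \<open>A summable majorant of the mass of a light cube of generation \<open>k\<close>. The
  number n is the first generation for which C * 2^(-a * n) <= t is guaranteed; from there on C *
  2^(-a * k) is at most t * 2^(-a * (k - n)).\<close>

definition small_bound :: "real \<Rightarrow> nat \<Rightarrow> real" where
  "small_bound t k = (let n = nat \<lceil>(log 2 (1 / t) + log 2 C) / a\<rceil> in
     if k < n then t else t * (2 powr (- a)) ^ (k - n))"

lemma measure_le_small_bound:
  assumes "0 < t" "Q \<in> dyadic_gen k" "measure \<nu> Q < t"
  shows "measure \<nu> Q \<le> small_bound t k"
proof -
  let ?K = "(log 2 (1 / t) + log 2 C) / a"
  define n where "n = nat \<lceil>?K\<rceil>"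
  have "measure \<nu> Q \<le> t * (2 powr (- a)) ^ (k - n)" if "n \<le> k"
  proof -
    have "?K \<le> real n" unfolding n_def by (rule real_nat_ceiling_ge)
    then have "log 2 C - log 2 t \<le> a * real n"
      using a_pos assms(1) by (simp add: field_simps log_divide)
    then have "log 2 C - a * real k \<le> log 2 t - a * real (k - n)"
      using that by (simp add: of_nat_diff algebra_simps)
    then have "2 powr (log 2 C - a * real k) \<le> 2 powr (log 2 t - a * real (k - n))"
      by simp
    then have "C * 2 powr (- a * real k) \<le> t * 2 powr (- a * real (k - n))"
      using C_ge_1 assms(1) by (simp add: powr_diff powr_minus divide_inverse)
    also have "2 powr (- a * real (k - n)) = (2 powr (- a)) ^ (k - n)"
      by (simp add: powr_realpow[symmetric] powr_powr)
    finally show ?thesis using measure_dyadic_gen_le[OF assms(2)] by linarith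
  qed
  then show ?thesis using assms(3) unfolding small_bound_def Let_def n_def[symmetric] by auto
qed

lemma small_bound_nonneg: "0 \<le> t \<Longrightarrow> 0 \<le> small_bound t k"
  by (simp add: small_bound_def Let_def)

text \<open>There are n terms equal to \<open>t\<close>, where n is at most linear in log (1 / t),
  and a geometric tail with sum t / (1 - 2^(-a)).\<close>

lemma small_bound_sums:
  assumes "0 < t" "t < 1"
  obtains s where "small_bound t sums s"
    "s \<le> (1 + (1 + log 2 C) / a + 1 / (1 - 2 powr (- a))) * (t * (1 + log 2 (1 / t)))"
proof -
  let ?K = "(log 2 (1 / t) + log 2 C) / a" and ?r = "2 powr (- a)"
  define n where "n = nat \<lceil>?K\<rceil>"
  have l: "0 \<le> log 2 (1 / t)" "0 \<le> log 2 C" using assms C_ge_1 by auto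
  have r: "0 < ?r" "?r < 1" using a_pos powr_less_mono[of "- a" 0 2] by auto
  have "(\<lambda>k. t * ?r ^ k) sums (t * (1 / (1 - ?r)))"
    using r by (intro sums_mult geometric_sums) auto
  moreover have "(\<lambda>k. small_bound t (k + n)) = (\<lambda>k. t * ?r ^ k)"
    by (simp add: small_bound_def Let_def n_def[symmetric])
  ultimately have "small_bound t sums (t * (1 / (1 - ?r)) + (\<Sum>k<n. small_bound t k))"
    by (metis sums_iff_shift)
  also have "(\<Sum>k<n. small_bound t k) = t * real n"
    by (simp add: small_bound_def Let_def n_def[symmetric])
  finally have sums: "small_bound t sums (t * (1 / (1 - ?r)) + t * real n)" .
  have "0 \<le> ?K" using l a_pos by simp
  then have "real n = real_of_int \<lceil>?K\<rceil>" unfolding n_def by simp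
  then have "real n \<le> 1 + ?K" using of_int_ceiling_le_add_one[of ?K] by linarith
  also have "?K = log 2 (1 / t) / a + log 2 C / a" by (rule add_divide_distrib)
  finally have "1 / (1 - ?r) + real n \<le> 1 + log 2 C / a + 1 / (1 - ?r) + (1 / a) * log 2 (1 / t)" by simp
  \<comment> \<open>The extra summand 1 / a in the constant absorbs the coefficient of log (1 /
    t).\<close>
  also have "\<dots> \<le> (1 + (1 + log 2 C) / a + 1 / (1 - ?r)) * (1 + log 2 (1 / t))"
  proof -
    have "0 \<le> (1 + log 2 C / a + 1 / (1 - ?r)) * log 2 (1 / t)"
      using l r a_pos by (intro mult_nonneg_nonneg add_nonneg_nonneg) auto
    moreover have "0 \<le> 1 / a" using a_pos by simp
    ultimately show ?thesis by (simp add: algebra_simps add_divide_distrib)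
  qed
  finally have "t * (1 / (1 - ?r) + real n) \<le> t * ((1 + (1 + log 2 C) / a + 1 / (1 - ?r)) * (1 + log 2 (1 / t)))"
    using assms(1) by (intro mult_left_mono) auto
  then show ?thesis
    by (intro that[OF sums]) (simp only: distrib_left[of t, symmetric] mult.left_commute[of _ t])
qed

text \<open>The heavy near cubes are replaced by all heavy cubes of the generation, so
  \<open>A\<close> enters the bound only through its cardinality.\<close>

lemma measure_near_cubes:
  assumes "0 < t" "finite A"
  shows "measure \<nu> (\<Union>(near_cubes A k))
    \<le> (\<Sum>Q | Q \<in> big_cubes \<nu> t \<and> gen Q = k. measure \<nu> Q) + 3 ^ CARD('n) * real (card A) * small_bound t k"
proof -
  let ?F = "near_cubes A k"
  have F: "?F \<subseteq> dyadic_gen k" "finite ?F" by (auto simp: near_cubes_def finite_dyadic_gen)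
  have "measure \<nu> (\<Union>?F) = (\<Sum>Q\<in>?F. measure \<nu> Q)"
    using F dyadic_genD dyadic_gen_eqI by (intro sum_measure_disjoint[symmetric]) blast+
  also have "\<dots> = (\<Sum>Q\<in>?F \<inter> big_cubes \<nu> t. measure \<nu> Q) + (\<Sum>Q\<in>?F - big_cubes \<nu> t. measure \<nu> Q)"
    using F(2) by (rule sum.Int_Diff)
  also have "(\<Sum>Q\<in>?F \<inter> big_cubes \<nu> t. measure \<nu> Q) \<le> (\<Sum>Q | Q \<in> big_cubes \<nu> t \<and> gen Q = k. measure \<nu> Q)"
    using F(1) finite_big_cubes[OF assms(1)] by (intro sum_mono2) (auto simp: gen_eq subset_iff)
  also have "(\<Sum>Q\<in>?F - big_cubes \<nu> t. measure \<nu> Q) \<le> (\<Sum>Q\<in>?F - big_cubes \<nu> t. small_bound t k)"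
  proof (rule sum_mono)
    fix Q assume Q: "Q \<in> ?F - big_cubes \<nu> t"
    then have "Q \<in> dyadic_gen k" using F(1) by blast
    then show "measure \<nu> Q \<le> small_bound t k"
      using Q dyadic_genD assms(1) by (intro measure_le_small_bound) (auto simp: big_cubes_def)
  qed
  also have "\<dots> = real (card (?F - big_cubes \<nu> t)) * small_bound t k" by simp
  also have "\<dots> \<le> (3 ^ CARD('n) * real (card A)) * small_bound t k"
  proof (rule mult_right_mono)
    have "card (?F - big_cubes \<nu> t) \<le> card ?F" using F(2) by (intro card_mono) auto
    also have "\<dots> \<le> 3 ^ CARD('n) * card A" by (rule card_near_cubes[OF assms(2)])
    finally have "real (card (?F - big_cubes \<nu> t)) \<le> real (3 ^ CARD('n) * card A)" by (simp only: of_nat_le_iff)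
    then show "real (card (?F - big_cubes \<nu> t)) \<le> 3 ^ CARD('n) * real (card A)" by simp
  qed (use small_bound_nonneg assms in auto)
  finally show ?thesis by simp
qed

lemma eintegral_ge:
  assumes "0 < t" "t < 1" "finite A" "A \<noteq> {}" "card A \<le> N"
  shows "eintegral \<nu> (\<lambda>x. eln (ereal (max_dist x A))) \<ge> ereal (- (ln 2 * (stop_cost \<nu> t +
    3 ^ CARD('n) * (1 + (1 + log 2 C) / a + 1 / (1 - 2 powr (- a))) * real N * t * (1 + log 2 (1 / t)))))"
proof -
  let ?f = "\<lambda>x. eln (ereal (max_dist x A))" and ?E = "\<lambda>k. \<Union>(near_cubes A k)"
  let ?c = "1 + (1 + log 2 C) / a + 1 / (1 - 2 powr (- a))"
  let ?b = "\<lambda>k. \<Sum>Q | Q \<in> big_cubes \<nu> t \<and> gen Q = k. measure \<nu> Q"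
  obtain s where s: "small_bound t sums s" "s \<le> ?c * (t * (1 + log 2 (1 / t)))"
    using small_bound_sums[OF assms(1,2)] .
  have E [measurable]: "?E k \<in> sets \<nu>" for k
    using finite_near_cubes
    by (intro sets.finite_Union) (auto simp: near_cubes_def intro!: dyadic_sets dest: dyadic_genD)
  \<comment> \<open>Only finitely many generations contain heavy cubes, and grouping these cubes by
    generation recovers \<open>stop_cost\<close>.\<close>
  have "?b sums (\<Sum>k\<in>gen ` big_cubes \<nu> t. ?b k)"
  proof (rule sums_finite)
    show "?b k = 0" if "k \<notin> gen ` big_cubes \<nu> t" for k
    proof -
      have "{Q. Q \<in> big_cubes \<nu> t \<and> gen Q = k} = {}" using that by blast
      then show ?thesis by (simp only: sum.empty)
    qed
  qed (use finite_big_cubes assms in auto)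
  also have "(\<Sum>k\<in>gen ` big_cubes \<nu> t. ?b k) = stop_cost \<nu> t"
    unfolding stop_cost_eq[OF assms(1,2)] using finite_big_cubes[OF assms(1)]
    by (intro sum.group) auto
  finally have b: "?b sums stop_cost \<nu> t" .
  have "(\<integral>\<^sup>+ x. e2ennreal (- ?f x) \<partial>\<nu>) \<le> (\<integral>\<^sup>+ x. (\<Sum>k. ennreal (ln 2) * indicator (?E k) x) \<partial>\<nu>)"
  proof (rule nn_integral_mono_AE, rule AE_mp[OF AE_root], rule AE_I2, rule impI)
    fix x :: "real ^ 'n" assume x: "x \<in> root_cube"
    have "e2ennreal (- ?f x) \<le> (\<Sum>k. ennreal (ln 2) * indicator {k. max_dist x A < 1 / 2 ^ k} k)"
      by (rule neg_eln_le_suminf)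
    also have "\<dots> \<le> (\<Sum>k. ennreal (ln 2) * indicator (?E k) x)"
    proof (rule suminf_le)
      fix k :: nat
      show "ennreal (ln 2) * indicator {k. max_dist x A < 1 / 2 ^ k} k \<le> ennreal (ln 2) * indicator (?E k) x"
        using near_cubes_cover[OF assms(3,4) x, of k]
        by (cases "max_dist x A < 1 / 2 ^ k") simp_all
    qed auto
    finally show "e2ennreal (- ?f x) \<le> (\<Sum>k. ennreal (ln 2) * indicator (?E k) x)" .
  qed
  also have "\<dots> = (\<Sum>k. \<integral>\<^sup>+ x. ennreal (ln 2) * indicator (?E k) x \<partial>\<nu>)"
    by (rule nn_integral_suminf) measurable
  also have "\<dots> = (\<Sum>k. ennreal (ln 2 * measure \<nu> (?E k)))"
    by (simp only: nn_integral_cmult_indicator[OF E] emeasure_eq_measure) (simp add: ennreal_mult')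
  also have "\<dots> \<le> (\<Sum>k. ennreal (ln 2 * (?b k + 3 ^ CARD('n) * real (card A) * small_bound t k)))"
    using measure_near_cubes[OF assms(1,3)]
    by (intro suminf_le ennreal_leI mult_left_mono) auto
  also have "\<dots> = ennreal (ln 2 * (stop_cost \<nu> t + 3 ^ CARD('n) * real (card A) * s))"
  proof (rule suminf_ennreal_eq)
    show "0 \<le> ln 2 * (?b k + 3 ^ CARD('n) * real (card A) * small_bound t k)" for k
      using small_bound_nonneg[of t k] assms(1)
      by (intro mult_nonneg_nonneg add_nonneg_nonneg sum_nonneg) auto
  qed (intro sums_mult sums_add b s)
  finally have "(\<integral>\<^sup>+ x. e2ennreal (- ?f x) \<partial>\<nu>)
      \<le> ennreal (ln 2 * (stop_cost \<nu> t + 3 ^ CARD('n) * real (card A) * s))" .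
  also have "\<dots> \<le> ennreal (ln 2 * (stop_cost \<nu> t + 3 ^ CARD('n) * ?c * real N * t * (1 + log 2 (1 / t))))"
  proof (intro ennreal_leI mult_left_mono add_left_mono)
    have s0: "0 \<le> s"
      using sums_le[OF _ sums_zero s(1)] small_bound_nonneg assms(1) by auto
    have "3 ^ CARD('n) * real (card A) * s \<le> 3 ^ CARD('n) * real N * s"
      using s0 assms(5) by (intro mult_right_mono mult_left_mono) auto
    also have "\<dots> \<le> 3 ^ CARD('n) * real N * (?c * (t * (1 + log 2 (1 / t))))"
      using s(2) by (intro mult_left_mono) auto
    finally show "3 ^ CARD('n) * real (card A) * s \<le> 3 ^ CARD('n) * ?c * real N * t * (1 + log 2 (1 / t))"
      by (simp only: mult_ac)
  qed simp
  finally have neg: "(\<integral>\<^sup>+ x. e2ennreal (- ?f x) \<partial>\<nu>) \<le> ennreal (ln 2 * (stop_cost \<nu> t +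
    3 ^ CARD('n) * ?c * real N * t * (1 + log 2 (1 / t))))" (is "?I \<le> ennreal ?X") .
  have "0 \<le> ?X"
  proof -
    have "0 \<le> stop_cost \<nu> t" unfolding stop_cost_eq[OF assms(1,2)] by (intro sum_nonneg) simp
    moreover have c: "0 \<le> ?c"
      using a_pos C_ge_1 powr_less_mono[of "- a" 0 2] by (intro add_nonneg_nonneg) auto
    moreover have "0 \<le> 1 + log 2 (1 / t)" using assms by simp
    then have "0 \<le> 3 ^ CARD('n) * ?c * real N * t * (1 + log 2 (1 / t))"
      using assms(1) by (intro mult_nonneg_nonneg c) auto
    ultimately show ?thesis by (intro mult_nonneg_nonneg[OF ln_ge_zero add_nonneg_nonneg]) auto
  qed
  then have "enn2ereal ?I \<le> ereal ?X"
    using neg by (metis enn2ereal_ennreal less_eq_ennreal.rep_eq)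
  then have "- ereal ?X \<le> - enn2ereal ?I" by (simp only: ereal_minus_le_minus)
  \<comment> \<open>The integral of the positive part is non-negative and is discarded.\<close>
  also have "\<dots> = 0 - enn2ereal ?I" by simp
  also have "\<dots> \<le> eintegral \<nu> ?f"
    unfolding eintegral_def by (intro ereal_minus_mono) auto
  finally show ?thesis by simp
qed

lemma Bq_le_Gam:
  assumes "0 < t" "t < 1"
  shows "Bq \<nu> N \<le> ereal (Gam \<nu> (Nt \<nu> t) +
    3 ^ CARD('n) * (1 + (1 + log 2 C) / a + 1 / (1 - 2 powr (- a))) * real N * t * (1 + log 2 (1 / t)))"
  unfolding Gam_Nt[OF assms]
proof (rule Bq_le)
  show "ereal (exp (- (ln 2 * (stop_cost \<nu> t + 3 ^ CARD('n) * (1 + (1 + log 2 C) / a + 1 / (1 - 2 powr (- a)))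
      * real N * t * (1 + log 2 (1 / t)))))) \<le> quant_err0 \<nu> N"
    unfolding quant_err0_def eexp_ereal[symmetric]
  proof (intro INF_greatest eexp_mono eintegral_ge[OF assms])
    fix A :: "(real ^ 'n) set" assume "A \<in> {A. finite A \<and> 1 \<le> card A \<and> card A \<le> N}"
    then show "finite A" "A \<noteq> {}" "card A \<le> N" by auto
  qed
qed

end

section \<open>Quantization dimensions\<close>

lemma liminf_compose_ge:
  fixes v :: "nat \<Rightarrow> ereal"
  assumes "filterlim g sequentially sequentially"
  shows "liminf v \<le> liminf (\<lambda>N. v (g N))"
  unfolding le_Liminf_iff
proof (intro allI impI)
  fix y assume "y < liminf v"
  then have "eventually (\<lambda>N. y < v N) sequentially"
    using le_Liminf_iff[of "liminf v" sequentially v] by simp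
  then show "eventually (\<lambda>N. y < v (g N)) sequentially"
    using assms by (rule eventually_compose_filterlim)
qed

lemma limsup_compose_le:
  fixes v :: "nat \<Rightarrow> ereal"
  assumes "filterlim g sequentially sequentially"
  shows "limsup (\<lambda>N. v (g N)) \<le> limsup v"
  unfolding Limsup_le_iff
proof (intro allI impI)
  fix y assume "y > limsup v"
  then have "eventually (\<lambda>N. v N < y) sequentially"
    using Limsup_le_iff[of sequentially v "limsup v"] by simp
  then show "eventually (\<lambda>N. v (g N) < y) sequentially"
    using assms by (rule eventually_compose_filterlim)
qed

lemma tendsto_add_const_ratio:
  fixes G :: "nat \<Rightarrow> real"
  assumes "filterlim G at_top sequentially"
  shows "(\<lambda>N. (G N + D) / G N) \<longlonglongrightarrow> 1" "(\<lambda>N. G N / (G N + D)) \<longlonglongrightarrow> 1"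
proof -
  have "((\<lambda>x. (x + D) / x) \<longlongrightarrow> 1) at_top" "((\<lambda>x. x / (x + D)) \<longlongrightarrow> 1) at_top"
    by real_asymp+
  then show "(\<lambda>N. (G N + D) / G N) \<longlonglongrightarrow> 1" "(\<lambda>N. G N / (G N + D)) \<longlonglongrightarrow> 1"
    using assms by (auto intro: filterlim_compose)
qed

text \<open>A bound for \<open>Nt \<nu> t\<close> at t = 1 / (N * L) with L = 1 + log N: one factor
  L comes from 1 / t, the other from \<open>Kbound\<close>.\<close>

definition blow_up :: "real \<Rightarrow> nat \<Rightarrow> nat" where
  "blow_up c N = nat \<lceil>c * real N * (1 + log 2 (real N)) ^ 2\<rceil>"

lemma blow_up_ge:
  assumes "1 \<le> c" "1 \<le> N"
  shows "N \<le> blow_up c N"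
proof -
  have "1 \<le> (1 + log 2 (real N)) ^ 2" using assms(2) by (intro one_le_power) simp
  then have "1 * real N * 1 \<le> c * real N * (1 + log 2 (real N)) ^ 2"
    using assms by (intro mult_mono) auto
  also have "\<dots> \<le> real (blow_up c N)" unfolding blow_up_def by (rule real_nat_ceiling_ge)
  finally show ?thesis by simp
qed

lemma filterlim_blow_up:
  assumes "1 \<le> c"
  shows "filterlim (blow_up c) sequentially sequentially"
  by (rule filterlim_at_top_mono[OF filterlim_ident])
    (rule eventually_mono[OF eventually_ge_at_top[of 1]], rule blow_up_ge[OF assms])

text \<open>The logarithm of the new index is log N plus a term of order log log N.\<close>

lemma log_blow_up:
  assumes "1 \<le> c"
  shows "(\<lambda>N. log 2 (real N) / log 2 (real (blow_up c N))) \<longlonglongrightarrow> 1"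
proof -
  have "c > 0" using assms by simp
  then show ?thesis unfolding blow_up_def log_def by real_asymp
qed

text \<open>An approximate inverse of \<open>blow_up c\<close>. The third power, one more than in
  \<open>blow_up\<close>, leaves a spare factor 1 + log N that absorbs \<open>c\<close> and the
  rounding.\<close>

definition shrink :: "nat \<Rightarrow> nat" where
  "shrink N = nat \<lfloor>real N / (1 + log 2 (real N)) ^ 3\<rfloor>"

lemma filterlim_shrink: "filterlim shrink sequentially sequentially"
  unfolding shrink_def log_def by real_asymp

lemma log_shrink: "(\<lambda>N. log 2 (real N) / log 2 (real (shrink N))) \<longlonglongrightarrow> 1"
  unfolding shrink_def log_def by real_asymp

lemma blow_up_shrink:
  assumes "1 \<le> c"
  shows "eventually (\<lambda>N. blow_up c (shrink N) \<le> N) sequentially"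
proof -
  \<comment> \<open>Here the spare factor is used; the summand 1 pays for the ceiling in
    \<open>blow_up\<close>.\<close>
  have "eventually (\<lambda>N. c * real N / (1 + log 2 (real N)) + 1 \<le> real N) sequentially"
    using assms unfolding log_def by real_asymp
  moreover have "eventually (\<lambda>N. 1 \<le> shrink N) sequentially"
    using filterlim_shrink unfolding filterlim_at_top by blast
  ultimately show ?thesis
    using eventually_ge_at_top[of 1]
  proof eventually_elim
    case (elim N)
    let ?L = "1 + log 2 (real N)" and ?h = "shrink N"
    have L: "1 \<le> ?L" using elim(3) by simp
    have h: "real ?h \<le> real N / ?L ^ 3"
      unfolding shrink_def using L by (intro of_nat_floor divide_nonneg_nonneg) auto
    have "real N / ?L ^ 3 \<le> real N / 1"
      using L by (intro divide_left_mono one_le_power) auto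
    then have "real ?h \<le> real N" using h by simp
    then have "log 2 (real ?h) \<le> log 2 (real N)" using elim(2) by simp
    then have "(1 + log 2 (real ?h)) ^ 2 \<le> ?L ^ 2" using elim(2) by (intro power_mono) auto
    then have "c * real ?h * (1 + log 2 (real ?h)) ^ 2 \<le> c * (real N / ?L ^ 3) * ?L ^ 2"
      using h assms L by (intro mult_mono) auto
    also have "\<dots> = c * real N / ?L"
    proof -
      have "c * (x / L ^ 3) * L ^ 2 = c * x / L" if "0 < L" for x L :: real
        using that by (simp add: field_simps power2_eq_square power3_eq_cube)
      then show ?thesis using L by simp
    qed
    finally have "c * real ?h * (1 + log 2 (real ?h)) ^ 2 \<le> c * real N / ?L" .
    moreover have "real (blow_up c ?h) \<le> c * real ?h * (1 + log 2 (real ?h)) ^ 2 + 1"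
    proof -
      have "0 \<le> c * real ?h * (1 + log 2 (real ?h)) ^ 2" using assms by (intro mult_nonneg_nonneg) auto
      then show ?thesis
        unfolding blow_up_def using of_int_ceiling_le_add_one by (simp only: of_nat_nat zero_le_ceiling)
    qed
    ultimately have "real (blow_up c ?h) \<le> real N" using elim(1) by linarith
    then show ?case by simp
  qed
qed

text \<open>The comparison \<open>G N \<le> B N \<le> G (blow_up c N) + D\<close> is useless for fixed \<open>N\<close>, as \<open>G\<close> may
  grow fast between \<open>N\<close> and \<open>blow_up c N\<close>. It suffices in the limit since \<open>blow_up c\<close> does not
  change \<open>log N\<close> to leading order: for the lower limit pass to the indices \<open>blow_up c N\<close>, for the
  upper limit to the indices \<open>shrink N\<close>.\<close>
lemma log_ratio_limits:
  fixes B G :: "nat \<Rightarrow> real"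
  assumes mono: "\<And>M N. 1 \<le> M \<Longrightarrow> M \<le> N \<Longrightarrow> G M \<le> G N"
    and lim: "filterlim G at_top sequentially"
    and le: "\<And>N. 1 \<le> N \<Longrightarrow> G N \<le> B N"
    and bound: "\<And>N. 2 \<le> N \<Longrightarrow> B N \<le> G (blow_up c N) + D"
    and c: "1 \<le> c"
  shows "liminf (\<lambda>N. ereal (log 2 (real N) / B N)) = liminf (\<lambda>N. ereal (log 2 (real N) / G N))"
    and "limsup (\<lambda>N. ereal (log 2 (real N) / B N)) = limsup (\<lambda>N. ereal (log 2 (real N) / G N))"
proof -
  define u where "u N = ereal (log 2 (real N) / B N)" for N
  define v where "v N = ereal (log 2 (real N) / G N)" for N
  let ?g = "blow_up c"
  \<comment> \<open>The entry 1 - D makes G + D at least 1, so all denominators are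
    positive.\<close>
  have G1: "eventually (\<lambda>N. max 1 (1 - D) \<le> G N) sequentially"
    using lim unfolding filterlim_at_top by blast
  have uv: "eventually (\<lambda>N. u N \<le> v N) sequentially"
    using G1 eventually_ge_at_top[of 1]
  proof eventually_elim
    case (elim N)
    then show ?case unfolding u_def v_def using le[of N] by (simp add: divide_left_mono)
  qed

  \<comment> \<open>The factor that turns the ratio at the index \<open>?g N\<close> into log N / (G
    (?g N) + D), a lower bound for \<open>u N\<close>. It tends to 1, so it does not affect the
    lower limit.\<close>
  define r where "r N = (log 2 (real N) / log 2 (real (?g N))) * (G (?g N) / (G (?g N) + D))" for N
  have "r \<longlonglongrightarrow> 1 * 1"
    unfolding r_def
    by (intro tendsto_mult log_blow_up[OF c]
        filterlim_compose[OF tendsto_add_const_ratio(2)[OF lim] filterlim_blow_up[OF c]])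
  then have r: "(\<lambda>N. ereal (r N)) \<longlonglongrightarrow> 1" by (simp add: one_ereal_def)
  have "eventually (\<lambda>N. ereal (r N) * v (?g N) \<le> u N) sequentially"
    using eventually_compose_filterlim[OF G1 filterlim_blow_up[OF c]] G1 eventually_ge_at_top[of 2]
  proof eventually_elim
    case (elim N)
    have "2 \<le> ?g N" using blow_up_ge[OF c, of N] elim(3) by simp
    then have "0 < log 2 (real (?g N))" by simp
    then have "r N * (log 2 (real (?g N)) / G (?g N)) = log 2 (real N) / (G (?g N) + D)"
      using elim unfolding r_def by simp
    also have "\<dots> \<le> log 2 (real N) / B N"
      using bound[of N] le[of N] elim by (intro divide_left_mono mult_pos_pos) auto
    finally show ?case unfolding u_def v_def by simp
  qed
  then have "liminf (\<lambda>N. ereal (r N) * v (?g N)) \<le> liminf u" by (rule Liminf_mono)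
  moreover have "liminf (\<lambda>N. ereal (r N) * v (?g N)) = 1 * liminf (\<lambda>N. v (?g N))"
    using r by (intro ereal_liminf_lim_mult) auto
  ultimately have "liminf v \<le> liminf u"
    using liminf_compose_ge[OF filterlim_blow_up[OF c], of v] by simp
  then show "liminf (\<lambda>N. ereal (log 2 (real N) / B N)) = liminf (\<lambda>N. ereal (log 2 (real N) / G N))"
    using Liminf_mono[OF uv] unfolding u_def v_def by simp

  \<comment> \<open>The counterpart for the upper limit: it turns log (shrink N) / (G N + D) into
    \<open>v N\<close>.\<close>
  define r' where "r' N = (log 2 (real N) / log 2 (real (shrink N))) * ((G N + D) / G N)" for N
  have "r' \<longlonglongrightarrow> 1 * 1"
    unfolding r'_def by (intro tendsto_mult log_shrink tendsto_add_const_ratio(1)[OF lim])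
  then have r': "(\<lambda>N. ereal (r' N)) \<longlonglongrightarrow> 1" by (simp add: one_ereal_def)
  have "eventually (\<lambda>N. 2 \<le> shrink N) sequentially"
    using filterlim_shrink unfolding filterlim_at_top by blast
  then have "eventually (\<lambda>N. v N \<le> ereal (r' N) * u (shrink N)) sequentially"
    using G1 eventually_compose_filterlim[OF G1 filterlim_shrink] blow_up_shrink[OF c]
      eventually_ge_at_top[of 1]
  proof eventually_elim
    case (elim N)
    let ?h = "shrink N"
    have "?h \<le> ?g ?h" using blow_up_ge[OF c, of ?h] elim(1) by simp
    \<comment> \<open>Since \<open>blow_up c (shrink N)\<close> is at most N, monotonicity of G
      brings the bound back to the index N.\<close>
    then have "B ?h \<le> G N + D"
      using bound[OF elim(1)] mono[of "?g ?h" N] elim(1,4) by linarith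
    moreover have "0 < B ?h" using le[of ?h] elim by simp
    ultimately have "log 2 (real ?h) / (G N + D) \<le> log 2 (real ?h) / B ?h"
      using elim(1) by (intro divide_left_mono mult_pos_pos) auto
    moreover have l: "0 < log 2 (real ?h)" using elim(1) by simp
    moreover have "0 \<le> r' N"
    proof -
      have "0 \<le> log 2 (real N)" using elim(5) by simp
      then show ?thesis unfolding r'_def using l elim(2) by (intro mult_nonneg_nonneg divide_nonneg_nonneg) auto
    qed
    ultimately have "r' N * (log 2 (real ?h) / (G N + D)) \<le> r' N * (log 2 (real ?h) / B ?h)"
      by (intro mult_left_mono)
    moreover have "r' N * (log 2 (real ?h) / (G N + D)) = log 2 (real N) / G N"
      using l elim(2) unfolding r'_def by simp
    ultimately show ?case unfolding u_def v_def by simp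
  qed
  then have "limsup v \<le> limsup (\<lambda>N. ereal (r' N) * u (shrink N))" by (rule Limsup_mono)
  moreover have "limsup (\<lambda>N. ereal (r' N) * u (shrink N)) = 1 * limsup (\<lambda>N. u (shrink N))"
    using r' by (intro ereal_limsup_lim_mult) auto
  ultimately have "limsup v \<le> limsup u"
    using limsup_compose_le[OF filterlim_shrink, of u] by simp
  then show "limsup (\<lambda>N. ereal (log 2 (real N) / B N)) = limsup (\<lambda>N. ereal (log 2 (real N) / G N))"
    using Limsup_mono[OF uv] unfolding u_def v_def by simp
qed

section \<open>Application to \<open>Bq\<close> and \<open>Gam\<close>\<close>

context regular_measure
begin

lemma filterlim_Gam: "filterlim (Gam \<nu>) at_top sequentially"
  unfolding filterlim_at_top
proof
  fix Z :: real
  show "eventually (\<lambda>N. Z \<le> Gam \<nu> N) sequentially"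
    using eventually_ge_at_top[of "(2 ^ nat \<lceil>Z\<rceil>) ^ CARD('n)"]
  proof eventually_elim
    case (elim N)
    have "Z \<le> real (nat \<lceil>Z\<rceil>)" by (rule real_nat_ceiling_ge)
    also have "\<dots> \<le> Gam \<nu> N" by (rule Gam_ge[OF elim])
    finally show ?case .
  qed
qed

text \<open>Finiteness follows by enclosing \<open>Bq\<close> between two real numbers; t = 1/2 is
  an arbitrary choice.\<close>

lemma Bq_real:
  assumes "1 \<le> N"
  shows "Bq \<nu> N = ereal (real_of_ereal (Bq \<nu> N))"
  using Gam_le_Bq[OF assms] Bq_le_Gam[of "1/2" N] by (cases "Bq \<nu> N") auto

lemma Bq_le_Gam_blow_up:
  obtains c D where "1 \<le> c" "\<And>N. 2 \<le> N \<Longrightarrow> real_of_ereal (Bq \<nu> N) \<le> Gam \<nu> (blow_up c N) + D"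
proof -
  define E where "E = 3 ^ CARD('n) * (1 + (1 + log 2 C) / a + 1 / (1 - 2 powr (- a)))"
  \<comment> \<open>Chosen so that \<open>Kbound a C t\<close> is at most \<kappa> * L; the 3 is the
    factor in log (1 / t) <= 3 * L.\<close>
  define \<kappa> where "\<kappa> = 1 + (3 + log 2 C) / a"
  have logC: "0 \<le> log 2 C" using C_ge_1 by simp
  have \<kappa>: "1 \<le> \<kappa>" unfolding \<kappa>_def using a_pos logC by simp
  \<comment> \<open>In 1 + 2^d * card the summand 1 is bounded by N * L^2 and the rest by 2^d *
    \<kappa> * N * L^2.\<close>
  define c where "c = 1 + 2 ^ CARD('n) * \<kappa>"
  have c: "1 \<le> c" unfolding c_def using \<kappa> by simp
  have "0 \<le> 1 / (1 - 2 powr (- a))" using a_pos powr_less_mono[of "- a" 0 2] by simp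
  moreover have "0 \<le> (1 + log 2 C) / a" using a_pos logC by simp
  ultimately have E: "0 \<le> E" unfolding E_def by (intro mult_nonneg_nonneg) auto
  have "real_of_ereal (Bq \<nu> N) \<le> Gam \<nu> (blow_up c N) + E * 4" if N: "2 \<le> N" for N
  proof -
    define L where "L = 1 + log 2 (real N)"
    \<comment> \<open>The value N = 1 would give t = 1; for N >= 2 one has N * L >= 4, hence t <
      1.\<close>
    define t where "t = 1 / (real N * L)"
    have "log 2 2 \<le> log 2 (real N)" using N by (subst log_le_cancel_iff) auto
    then have L: "2 \<le> L" unfolding L_def by simp
    have NL: "4 \<le> real N * L" using N L mult_mono[of 2 "real N" 2 L] by simp
    then have t: "0 < t" "t < 1" unfolding t_def by auto
    have "log 2 L \<le> 2 * L"
    proof -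
      have "ln L \<le> L" using ln_bound[of L] L by simp
      also have "\<dots> \<le> (2 * L) * ln 2" using ln2_ge_two_thirds L mult_left_mono[of "2/3" "ln 2" "2 * L"] by simp
      finally show ?thesis unfolding log_def by (simp add: field_simps)
    qed
    moreover have "log 2 (1 / t) = log 2 (real N) + log 2 L"
      unfolding t_def using N L by (simp add: log_mult)
    ultimately have lt: "log 2 (1 / t) \<le> 3 * L" unfolding L_def by simp
    have "real N * t * (1 + log 2 (1 / t)) \<le> real N * t * (4 * L)"
      using lt L t by (intro mult_left_mono) auto
    also have "\<dots> = 4" unfolding t_def using N L by simp
    finally have "E * (real N * t * (1 + log 2 (1 / t))) \<le> E * 4"
      using E by (rule mult_left_mono)
    moreover have "ereal (real_of_ereal (Bq \<nu> N)) \<le> ereal (Gam \<nu> (Nt \<nu> t) + E * real N * t * (1 + log 2 (1 / t)))"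
      using Bq_le_Gam[OF t, of N] Bq_real[of N] N unfolding E_def by simp
    moreover have "Gam \<nu> (Nt \<nu> t) \<le> Gam \<nu> (blow_up c N)"
    proof (rule Gam_mono)
      show "1 \<le> Nt \<nu> t" by (simp add: Nt_def)
      have "Kbound a C t \<le> \<kappa> * L"
      proof -
        have "log 2 C \<le> log 2 C * L" using logC L by (simp add: mult_le_cancel_left1)
        then have "(log 2 (1 / t) + log 2 C) / a \<le> ((3 + log 2 C) * L) / a"
          using lt a_pos by (intro divide_right_mono) (auto simp: algebra_simps)
        then show ?thesis unfolding Kbound_def \<kappa>_def using L by (simp add: distrib_right)
      qed
      then have "(1 / t) * Kbound a C t \<le> (1 / t) * (\<kappa> * L)"
        using t by (intro mult_left_mono) auto
      also have "\<dots> = \<kappa> * (real N * L ^ 2)" unfolding t_def by (simp add: power2_eq_square)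
      finally have card: "real (card (big_cubes \<nu> t)) \<le> \<kappa> * (real N * L ^ 2)"
        using card_big_cubes[OF t] by linarith
      have "real (Nt \<nu> t) \<le> 1 + 2 ^ CARD('n) * real (card (big_cubes \<nu> t))"
        unfolding Nt_def by (simp add: mult_right_mono of_nat_diff)
      also have "\<dots> \<le> real N * L ^ 2 + 2 ^ CARD('n) * (\<kappa> * (real N * L ^ 2))"
      proof (intro add_mono mult_left_mono card)
        show "1 \<le> real N * L ^ 2"
          using N L mult_mono[of 1 "real N" 1 "L ^ 2"] one_le_power[of L 2] by simp
      qed simp
      also have "\<dots> = c * real N * L ^ 2" unfolding c_def by (simp add: algebra_simps)
      also have "\<dots> \<le> real (blow_up c N)" unfolding blow_up_def L_def by (rule real_nat_ceiling_ge)
      finally show "Nt \<nu> t \<le> blow_up c N" by simp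
    qed
    ultimately show ?thesis unfolding ereal_less_eq mult.assoc by linarith
  qed
  with c that show ?thesis by blast
qed

lemma D0_eq:
  shows "lower_D0 \<nu> = liminf (\<lambda>N. ereal (log 2 (real N) / Gam \<nu> N))"
    and "upper_D0 \<nu> = limsup (\<lambda>N. ereal (log 2 (real N) / Gam \<nu> N))"
proof -
  let ?B = "\<lambda>N. real_of_ereal (Bq \<nu> N)"
  obtain c D where c: "1 \<le> c" and bound: "\<And>N. 2 \<le> N \<Longrightarrow> ?B N \<le> Gam \<nu> (blow_up c N) + D"
    using Bq_le_Gam_blow_up by blast
  have le: "Gam \<nu> N \<le> ?B N" if "1 \<le> N" for N
    using Gam_le_Bq[OF that] Bq_real[OF that] by (metis ereal_less_eq(3))
  have "eventually (\<lambda>N. 1 \<le> Gam \<nu> N) sequentially"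
    using filterlim_Gam unfolding filterlim_at_top by blast
  \<comment> \<open>Extended and real division may disagree at a zero denominator, so the two ratios
    are identified only where \<open>Bq\<close> is known to be positive.\<close>
  then have eq: "eventually (\<lambda>N. ereal (log 2 (real N)) / Bq \<nu> N = ereal (log 2 (real N) / ?B N)) sequentially"
    using eventually_ge_at_top[of 1]
  proof eventually_elim
    case (elim N)
    then have "?B N \<noteq> 0" using le[of N] by simp
    then show ?case by (subst Bq_real[OF elim(2)]) simp
  qed
  note lims = log_ratio_limits[where G = "Gam \<nu>" and B = ?B, OF Gam_mono filterlim_Gam le bound c]
  show "lower_D0 \<nu> = liminf (\<lambda>N. ereal (log 2 (real N) / Gam \<nu> N))"
    unfolding lower_D0_def using Liminf_eq[OF eq] lims(1) by simp
  show "upper_D0 \<nu> = limsup (\<lambda>N. ereal (log 2 (real N) / Gam \<nu> N))"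
    unfolding upper_D0_def using Limsup_eq[OF eq] lims(2) by simp
qed

end

theorem proposition2p7:
  fixes a C :: real
  assumes "a > 0" and "C \<ge> 1"
  shows "\<exists>C3 :: real. \<forall>\<nu> :: (real ^ 'n) measure. dyadic_regular a C \<nu> \<longrightarrow>
    (\<forall>t. 0 < t \<and> t < 1 \<longrightarrow>
       stop_cost \<nu> t = (\<Sum>Q | Q \<in> dyadic \<and> measure \<nu> Q \<ge> t. measure \<nu> Q) \<and>
       stop_cost \<nu> t = (\<Sum>Q \<in> big_cubes \<nu> t. measure \<nu> Q) \<and>
       finite (big_cubes \<nu> t) \<and>
       real (card (big_cubes \<nu> t)) \<le> (1 / t) * Kbound a C t) \<and>
    (\<forall>P \<in> dyadic_partitions.
       finite (split_cubes P) \<and>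
       card P = 1 + (2 ^ CARD('n) - 1) * card (split_cubes P) \<and>
       part_cost \<nu> P = (\<Sum>Q \<in> split_cubes P. measure \<nu> Q)) \<and>
    (\<forall>t. 0 < t \<and> t < 1 \<longrightarrow>
       stop_part_full \<nu> t = stop_part \<nu> t \<union> null_children \<nu> (big_cubes \<nu> t) \<and>
       stop_part_full \<nu> t \<in> dyadic_partitions \<and>
       split_cubes (stop_part_full \<nu> t) = big_cubes \<nu> t \<and>
       card (stop_part_full \<nu> t) = Nt \<nu> t \<and>
       Nt \<nu> t \<ge> stop_card \<nu> t \<and>
       part_cost \<nu> (stop_part_full \<nu> t) = stop_cost \<nu> t \<and>
       (\<forall>P \<in> dyadic_partitions. card P \<le> Nt \<nu> t \<longrightarrow> part_cost \<nu> P \<le> stop_cost \<nu> t) \<and>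
       Gam \<nu> (Nt \<nu> t) = stop_cost \<nu> t) \<and>
    (\<forall>N t. N \<ge> 1 \<and> 0 < t \<and> t < 1 \<longrightarrow>
       ereal (Gam \<nu> N) \<le> Bq \<nu> N \<and>
       Bq \<nu> N \<le> ereal (Gam \<nu> (Nt \<nu> t) + C3 * real N * t * (1 + log 2 (1 / t)))) \<and>
    lower_D0 \<nu> = liminf (\<lambda>N. ereal (log 2 (real N) / Gam \<nu> N)) \<and>
    upper_D0 \<nu> = limsup (\<lambda>N. ereal (log 2 (real N) / Gam \<nu> N))"
proof (intro exI allI impI)
  fix \<nu> :: "(real ^ 'n) measure"
  assume reg: "dyadic_regular a C \<nu>"
  interpret regular_measure \<nu> a C
    by unfold_locales (use assms reg in auto)
  \<comment> \<open>The witness for \<open>C3\<close> is introduced before \<nu> is fixed, so it can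
    depend only on \<open>a\<close>, \<open>C\<close> and the dimension. It is the constant of
    \<open>Bq_le_Gam\<close>.\<close>
  show "(\<forall>t. 0 < t \<and> t < 1 \<longrightarrow>
       stop_cost \<nu> t = (\<Sum>Q | Q \<in> dyadic \<and> measure \<nu> Q \<ge> t. measure \<nu> Q) \<and>
       stop_cost \<nu> t = (\<Sum>Q \<in> big_cubes \<nu> t. measure \<nu> Q) \<and>
       finite (big_cubes \<nu> t) \<and>
       real (card (big_cubes \<nu> t)) \<le> (1 / t) * Kbound a C t) \<and>
    (\<forall>P \<in> dyadic_partitions.
       finite (split_cubes P) \<and>
       card P = 1 + (2 ^ CARD('n) - 1) * card (split_cubes P) \<and>
       part_cost \<nu> P = (\<Sum>Q \<in> split_cubes P. measure \<nu> Q)) \<and>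
    (\<forall>t. 0 < t \<and> t < 1 \<longrightarrow>
       stop_part_full \<nu> t = stop_part \<nu> t \<union> null_children \<nu> (big_cubes \<nu> t) \<and>
       stop_part_full \<nu> t \<in> dyadic_partitions \<and>
       split_cubes (stop_part_full \<nu> t) = big_cubes \<nu> t \<and>
       card (stop_part_full \<nu> t) = Nt \<nu> t \<and>
       Nt \<nu> t \<ge> stop_card \<nu> t \<and>
       part_cost \<nu> (stop_part_full \<nu> t) = stop_cost \<nu> t \<and>
       (\<forall>P \<in> dyadic_partitions. card P \<le> Nt \<nu> t \<longrightarrow> part_cost \<nu> P \<le> stop_cost \<nu> t) \<and>
       Gam \<nu> (Nt \<nu> t) = stop_cost \<nu> t) \<and>
    (\<forall>N t. N \<ge> 1 \<and> 0 < t \<and> t < 1 \<longrightarrow>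
       ereal (Gam \<nu> N) \<le> Bq \<nu> N \<and>
       Bq \<nu> N \<le> ereal (Gam \<nu> (Nt \<nu> t) +
         (3 ^ CARD('n) * (1 + (1 + log 2 C) / a + 1 / (1 - 2 powr (- a)))) * real N * t * (1 + log 2 (1 / t)))) \<and>
    lower_D0 \<nu> = liminf (\<lambda>N. ereal (log 2 (real N) / Gam \<nu> N)) \<and>
    upper_D0 \<nu> = limsup (\<lambda>N. ereal (log 2 (real N) / Gam \<nu> N))"
    \<comment> \<open>This turns the sum over an explicit set of cubes into the sum over
      \<open>big_cubes \<nu> t\<close>, so \<open>stop_cost_eq\<close> proves both forms.\<close>
    unfolding big_cubes_def[symmetric]
    by (intro conjI allI ballI impI; (elim conjE)?;
        rule stop_cost_eq finite_big_cubes card_big_cubes finite_split_cubes card_dyadic_partition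
          part_cost_split stop_part_full_eq stop_part_full_partition split_cubes_stop_part
          card_stop_part_full stop_card_le part_cost_stop_part part_cost_le_stop_cost Gam_Nt
          Gam_le_Bq Bq_le_Gam D0_eq; assumption)
qed

end
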